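(* Let $0<\alpha<n$ and let $T$ be an operator defined pointwise on $C_c^\infty(\mathbb R^n)$. The following are equivalent: (1) There is a constant $c$ such that $$|Tf(x)|\le c\,I_\alpha(|\nabla f|)(x)$$ for all $x\in\mathbb R^n$ and all $f\in C_c^\infty(\mathbb R^n)$. (2) There is a constant $C$ such that $$\|Tf\|_{L^{\frac n{n-\alpha},\infty}(\mu)}\le C\int_{\mathbb R^n}|\nabla f(x)|\,\big(M\mu(x)\big)^{1-\frac\alpha n}\,dx$$ for every locally finite Borel measure $\mu$ on $\mathbb R^n$ and every $f\in C_c^\infty(\mathbb R^n)$.
   Context: $n$ is a positive integer. "Operator defined pointwise on $C_c^\infty(\mathbb R^n)$" means that $T$ assigns to each $f\in C_c^\infty(\mathbb R^n)$ a (Borel measurable) function $Tf$ whose value $Tf(x)$ is defined at every point $x\in\mathbb R^n$. The Riesz potential is $I_\alpha g(x)=c_{n,\alpha}\int_{\mathbb R^n}\frac{g(y)}{|x-y|^{n-\alpha}}\,dy$, where the constant $c_{n,\alpha}>0$ is chosen so that $\widehat{I_\alpha g}(\xi)=|\xi|^{-\alpha}\hat g(\xi)$. For a (nonnegative) Borel measure $\mu$, $M\mu(x)=\sup_{Q\ni x}\frac{\mu(Q)}{|Q|}$, the supremum over all cubes $Q\subset\mathbb R^n$ containing $x$ (values in $[0,\infty]$, with $0\cdot\infty=0$ in the integral in (2)). For $0<q<\infty$, $\|g\|_{L^{q,\infty}(\mu)}=\sup_{t>0}t\,\mu(\{x:|g(x)|>t\})^{1/q}$. *)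

theory Defs
  imports "HOL-Analysis.Analysis"
begin

text \<open>
  Scalars: test functions take values in an arbitrary type of class \<open>real_normed_field\<close>.
  By Gelfand--Mazur such a field is isomorphic to \<open>real\<close> or \<open>complex\<close>, so the development
  covers real-valued and complex-valued test functions at once.
\<close>

definition partial_deriv :: "'n::finite \<Rightarrow> (real^'n \<Rightarrow> 'k::real_normed_vector) \<Rightarrow> real^'n \<Rightarrow> 'k"
  where "partial_deriv i f x = frechet_derivative f (at x) (axis i 1)"

text \<open>
  If every iterated partial derivative is differentiable everywhere, then all of them are
  continuous, so this is smoothness of class $C^\infty$.
\<close>

definition smooth :: "(real^'n::finite \<Rightarrow> 'k::real_normed_vector) \<Rightarrow> bool"
  where "smooth f \<longleftrightarrow> (\<forall>is x. foldr partial_deriv is f differentiable (at x))"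

definition Cc_infty :: "(real^'n::finite \<Rightarrow> 'k::real_normed_vector) set"
  where "Cc_infty = {f. smooth f \<and> compact (closure {x. f x \<noteq> 0})}"

text \<open>
  The norm of \<open>gradient f x\<close> is the Euclidean one of \<open>'k^'n\<close>, i.e. the square root of
  the sum of the squared norms of the partial derivatives.
\<close>

definition gradient :: "(real^'n::finite \<Rightarrow> 'k::real_normed_vector) \<Rightarrow> real^'n \<Rightarrow> 'k^'n"
  where "gradient f x = (\<chi> i. partial_deriv i f x)"

definition fourier :: "(real^'n::finite \<Rightarrow> complex) \<Rightarrow> real^'n \<Rightarrow> complex"
  where "fourier g \<xi> = (\<integral>x. exp (- \<i> * complex_of_real (x \<bullet> \<xi>)) * g x \<partial>lborel)"

definition riesz_with_const ::
    "real \<Rightarrow> real \<Rightarrow> (real^'n::finite \<Rightarrow> 'b::{banach,second_countable_topology}) \<Rightarrow> real^'n \<Rightarrow> 'b"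
  where "riesz_with_const c \<alpha> g x =
    c *\<^sub>R (\<integral>y. (1 / norm (x - y) powr (real CARD('n) - \<alpha>)) *\<^sub>R g y \<partial>lborel)"

text \<open>
  The function $I_\alpha g$ is in general not integrable, so the identity
  $\widehat{I_\alpha g} = |\xi|^{-\alpha} \hat g$ is one of tempered distributions: the Fourier
  transform of a function $u$ is the distribution $\varphi \mapsto \int u \hat\varphi$. Since
  $C_c^\infty$ is dense in the Schwartz space, it suffices to test against $\varphi$ in
  $C_c^\infty$.
\<close>

definition riesz_normalizes :: "'n::finite itself \<Rightarrow> real \<Rightarrow> real \<Rightarrow> bool"
  where "riesz_normalizes _ \<alpha> c \<longleftrightarrow>
    (\<forall>g \<in> Cc_infty. \<forall>\<phi> \<in> Cc_infty.
      (\<integral>x. riesz_with_const c \<alpha> g x * fourier \<phi> x \<partial>(lborel :: (real^'n) measure)) =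
      (\<integral>\<xi>. complex_of_real (norm \<xi> powr (- \<alpha>)) * fourier g \<xi> * \<phi> \<xi> \<partial>lborel))"

text \<open>
  For $0 < \alpha < n$ exactly one positive constant has this property, namely
  $\Gamma((n-\alpha)/2) / (2^\alpha \pi^{n/2} \Gamma(\alpha/2))$.
\<close>

definition riesz_const :: "'n::finite itself \<Rightarrow> real \<Rightarrow> real"
  where "riesz_const N \<alpha> = (SOME c. c > 0 \<and> riesz_normalizes N \<alpha> c)"

definition riesz_potential ::
    "real \<Rightarrow> (real^'n::finite \<Rightarrow> 'b::{banach,second_countable_topology}) \<Rightarrow> real^'n \<Rightarrow> 'b"
  where "riesz_potential \<alpha> = riesz_with_const (riesz_const TYPE('n) \<alpha>) \<alpha>"

text \<open>Powers of extended nonnegative reals; only positive exponents are used.\<close>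

definition ennpow :: "ennreal \<Rightarrow> real \<Rightarrow> ennreal"
  where "ennpow a p = (if a = \<infinity> then \<infinity> else ennreal (enn2real a powr p))"

definition locally_finite_borel :: "(real^'n::finite) measure \<Rightarrow> bool"
  where "locally_finite_borel \<mu> \<longleftrightarrow>
    sets \<mu> = sets borel \<and> (\<forall>x. \<exists>U. open U \<and> x \<in> U \<and> emeasure \<mu> U < \<infinity>)"

text \<open>
  Cubes are nondegenerate, closed and have sides parallel to the axes. The supremum in the
  maximal function is the same for open cubes, by approximation of the cubes from inside and
  outside.
\<close>

definition cubes :: "(real^'n::finite) set set"
  where "cubes = {cbox a (a + (\<chi> i. l)) | a l. l > 0}"

definition maximal :: "(real^'n::finite) measure \<Rightarrow> real^'n \<Rightarrow> ennreal"
  where "maximal \<mu> x = (SUP Q \<in> {Q \<in> cubes. x \<in> Q}. emeasure \<mu> Q / emeasure lborel Q)"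

definition weak_norm :: "real \<Rightarrow> 'a measure \<Rightarrow> ('a \<Rightarrow> 'b::real_normed_vector) \<Rightarrow> ennreal"
  where "weak_norm q \<mu> g =
    (SUP t \<in> {0::real<..}. ennreal t * ennpow (emeasure \<mu> {x \<in> space \<mu>. norm (g x) > t}) (1 / q))"

end

theory Submission
  imports Defs "HOL-Probability.Probability"
begin

text \<open>
  Write \<open>n\<close> for the dimension. The kernel of the Riesz potential is a constant times
  \<open>\<bar>x - y\<bar> powr (\<alpha> - n)\<close>, and both implications compare it with the maximal function.

  From (1) to (2). Let \<open>F\<close> be a subset of finite measure of \<open>{\<bar>T f\<bar> > t}\<close>. Integrating (1) over \<open>F\<close>
  and applying Fubini gives
  \<open>t \<mu>(F) \<le> c \<integral> \<bar>grad f(y)\<bar> (\<integral>x\<in>F. \<bar>x - y\<bar> powr (\<alpha> - n) d\<mu>(x)) dy\<close>.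
  A ball of radius \<open>\<rho>\<close> about \<open>y\<close> lies in a cube of side \<open>2 \<rho>\<close>, so its measure is at most
  \<open>(2 \<rho>)^n M\<mu>(y)\<close>. Cutting the inner integral into dyadic shells below a radius \<open>r\<close> and using
  \<open>\<mu>(F)\<close> above it, the choice \<open>r^n = \<mu>(F) / M\<mu>(y)\<close> bounds the inner integral by a constant times
  \<open>\<mu>(F) powr (\<alpha>/n) * M\<mu>(y) powr (1 - \<alpha>/n)\<close>; this is \<open>kernel_integral_le_maximal\<close>. Dividing by
  \<open>\<mu>(F) powr (\<alpha>/n)\<close> and exhausting the level set gives (2); this is \<open>riesz_weak_type\<close>.

  From (2) to (1). Apply (2) to the Dirac measure at \<open>x\<close>. The weak norm of \<open>T f\<close> is then at
  least \<open>\<bar>T f(x)\<bar>\<close>, and a cube containing \<open>x\<close> and \<open>y\<close> has side at least \<open>\<bar>x - y\<bar> / n\<close>, so the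
  maximal function of the Dirac measure at \<open>y\<close> is at most \<open>(n / \<bar>x - y\<bar>)^n\<close>. Its power
  \<open>1 - \<alpha>/n\<close> is a constant times the Riesz kernel.

  The second implication divides by the normalizing constant of the potential, which is specified
  only by the identity it has to satisfy. Hence a large part of the development shows that a
  positive constant with this property exists (\<open>riesz_normalizes_exists\<close>). The argument
  subordinates powers of the norm to Gaussians: with \<open>\<gamma> = n - \<alpha>\<close>,
  \<open>\<bar>x\<bar> powr (- \<gamma>)\<close> is a constant times \<open>\<integral> exp (\<gamma> u / 2 - \<bar>x\<bar>^2 exp u) du\<close>,
  and taking Fourier transforms under this integral turns it into the corresponding integral for
  \<open>\<bar>\<xi>\<bar> powr (- \<alpha>)\<close>. The exchanges of integrals are justified by local integrability of the
  kernels (\<open>powr_potential_bound\<close>) and integrability of the Fourier transform of a test function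
  (\<open>fourier_integrable\<close>).
\<close>

section \<open>Powers of the norm as mixtures of Gaussians\<close>

lemma nn_integral_exp_neg_finite:
  fixes d :: real
  assumes "d > 0"
  shows "(\<integral>\<^sup>+u. ennreal (exp (- d * \<bar>u\<bar>)) \<partial>lborel) < \<infinity>"
proof -
  have pos: "(\<integral>\<^sup>+u. ennreal (exp (- d * u)) * indicator {0..} u \<partial>lborel) = ennreal (0 - (- (1/d) * exp (- d * 0)))"
  proof (rule nn_integral_FTC_atLeast[where F = "\<lambda>u. - (1/d) * exp (- d * u)"])
    show "((\<lambda>u. - (1/d) * exp (- d * u)) has_real_derivative exp (- d * x)) (at x)" for x
      using assms by (auto intro!: derivative_eq_intros)
    have "((\<lambda>u. exp (- (d * u))) \<longlongrightarrow> 0) at_top"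
      using assms by real_asymp
    then show "((\<lambda>u. - (1/d) * exp (- d * u)) \<longlongrightarrow> 0) at_top"
      using tendsto_mult_right[of "\<lambda>u. exp (- (d * u))" 0 at_top "-(1/d)"] by simp
  qed auto
  have neg: "(\<integral>\<^sup>+u. ennreal (exp (- d * u)) * indicator {0..} u \<partial>lborel) =
     (\<integral>\<^sup>+u. ennreal (exp (d * u)) * indicator {..0} u \<partial>lborel)"
    by (subst nn_integral_real_affine[where c="-1" and t=0]) (auto intro!: nn_integral_cong simp: indicator_def)
  have "(\<integral>\<^sup>+u. ennreal (exp (- d * \<bar>u\<bar>)) \<partial>lborel) \<le>
     (\<integral>\<^sup>+u. ennreal (exp (- d * u)) * indicator {0..} u + ennreal (exp (d * u)) * indicator {..0} u \<partial>lborel)"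
    by (intro nn_integral_mono) (auto simp: indicator_def)
  also have "\<dots> = ennreal (1/d) + ennreal (1/d)"
    using pos neg by (subst nn_integral_add) auto
  finally show ?thesis
    by (rule order.strict_trans1) simp
qed

text \<open>
  The integral defining the Gamma function, \<open>G = \<Gamma>(a)\<close>, in the variable \<open>u = ln s\<close>. In this variable
  the homogeneity in \<open>r\<close> is a translation by \<open>ln r\<close>, and the passage from \<open>s\<close> to \<open>1/s\<close>, which occurs
  on the Fourier side, is the reflection in \<open>mellin_exp_reflected\<close>.
\<close>

lemma mellin_exp:
  fixes a :: real
  assumes "a > 0"
  shows "\<exists>G>0. \<forall>r>0. (\<integral>\<^sup>+u. ennreal (exp (a * u - r * exp u)) \<partial>lborel) = ennreal (G * r powr (- a))"
proof -
  define N where "N = (\<integral>\<^sup>+u. ennreal (exp (a * u - exp u)) \<partial>lborel)"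
  define d where "d = min a 1"
  \<comment> \<open>For positive \<open>u\<close>, the tangent of \<open>exp\<close> at \<open>ln (a + 1)\<close> has slope \<open>a + 1\<close> and thus leaves a decay \<open>exp (- u)\<close>.\<close>
  define C where "C = \<bar>(a + 1) * (1 - ln (a + 1))\<bar>"
  have d: "d > 0" "d \<le> a" "d \<le> 1" using assms by (auto simp: d_def)
  have bound: "a * u - exp u \<le> C + (- d * \<bar>u\<bar>)" for u :: real
  proof (cases "u \<le> 0")
    case True
    have "a * u \<le> d * u" using True d by (simp add: mult_right_mono_neg)
    moreover have "exp u > 0" by simp
    moreover have "C \<ge> 0" by (simp add: C_def)
    moreover have "- d * \<bar>u\<bar> = d * u" using True by simp
    ultimately show ?thesis by linarith
  next
    case False
    have "1 + (u - ln (a + 1)) \<le> exp (u - ln (a + 1))" by (rule exp_ge_add_one_self)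
    also have "\<dots> = exp u / (a + 1)" using assms by (simp add: exp_diff)
    finally have "(a + 1) * (1 + (u - ln (a + 1))) \<le> exp u"
      using assms by (simp add: field_simps)
    then have "a * u - exp u \<le> - u - (a + 1) * (1 - ln (a + 1))" by (simp add: algebra_simps)
    also have "\<dots> \<le> - u + C" by (simp add: C_def)
    also have "\<dots> \<le> C + (- d * \<bar>u\<bar>)" using False d
      using mult_right_mono[of d 1 u] by simp
    finally show ?thesis .
  qed
  have "N \<le> (\<integral>\<^sup>+u. ennreal (exp C) * ennreal (exp (- d * \<bar>u\<bar>)) \<partial>lborel)"
    unfolding N_def
    by (intro nn_integral_mono, subst ennreal_mult[symmetric])
       (use bound in \<open>auto simp: exp_add[symmetric] intro!: ennreal_leI\<close>)
  also have "\<dots> = ennreal (exp C) * (\<integral>\<^sup>+u. ennreal (exp (- d * \<bar>u\<bar>)) \<partial>lborel)"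
    by (rule nn_integral_cmult) auto
  also have "\<dots> < \<infinity>"
    using nn_integral_exp_neg_finite[OF d(1)] by (simp add: ennreal_mult_less_top)
  finally have fin: "N < \<infinity>" .
  have "N \<noteq> 0"
  proof
    assume "N = 0"
    then have "AE u in lborel. ennreal (exp (a * u - exp u)) = 0"
      unfolding N_def by (subst (asm) nn_integral_0_iff_AE) auto
    then have "AE u in (lborel::real measure). False" by simp
    then show False by (simp add: eventually_False ae_filter_eq_bot_iff)
  qed
  then obtain G where G: "G > 0" "N = ennreal G"
    using fin by (cases N) (auto simp: less_le)
  have "(\<integral>\<^sup>+u. ennreal (exp (a * u - r * exp u)) \<partial>lborel) = ennreal (G * r powr (- a))" if r: "r > 0" for r :: real
  proof -
    have "(\<integral>\<^sup>+u. ennreal (exp (a * u - r * exp u)) \<partial>lborel) =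
        (\<integral>\<^sup>+u. ennreal (exp (a * (- ln r + u) - r * exp (- ln r + u))) \<partial>lborel)"
      by (subst nn_integral_real_affine[where c=1 and t="- ln r"]) auto
    also have "\<dots> = (\<integral>\<^sup>+u. ennreal (r powr (- a)) * ennreal (exp (a * u - exp u)) \<partial>lborel)"
      using r by (intro nn_integral_cong, subst ennreal_mult[symmetric])
         (auto simp: powr_def exp_add[symmetric] exp_diff exp_minus algebra_simps divide_simps)
    also have "\<dots> = ennreal (r powr (- a)) * N"
      unfolding N_def by (rule nn_integral_cmult) auto
    finally show ?thesis using G r by (simp add: ennreal_mult[symmetric] mult.commute)
  qed
  then show ?thesis using G by blast
qed

lemma mellin_exp_reflected:
  fixes a :: real
  shows "(\<integral>\<^sup>+u. ennreal (exp (- a * u - r * exp (- u))) \<partial>lborel) = (\<integral>\<^sup>+u. ennreal (exp (a * u - r * exp u)) \<partial>lborel)"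
  by (subst nn_integral_real_affine[where c="-1" and t=0]) auto

text \<open>
  An affine change of variables reduces this to the characteristic function of the standard
  normal distribution.
\<close>

lemma gaussian_fourier_real:
  fixes s y \<xi> :: real
  assumes s: "s > 0"
  shows "has_bochner_integral lborel
     (\<lambda>x. complex_of_real (exp (- s * (x - y)^2)) * exp (- \<i> * complex_of_real (x * \<xi>)))
     (complex_of_real (sqrt (pi / s) * exp (- (\<xi>^2) / (4 * s))) * exp (- \<i> * complex_of_real (y * \<xi>)))"
proof -
  define c where "c = sqrt (2 * s)"
  have c: "c > 0" "c^2 = 2 * s" using s by (auto simp: c_def)
  \<comment> \<open>The substitution \<open>x \<mapsto> c * (x - y)\<close> turns \<open>x\<^sup>2/2\<close> into \<open>s * (x - y)\<^sup>2\<close>; then the frequency \<open>t\<close> becomes \<open>c * t\<close>.\<close>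
  define t where "t = - \<xi> / c"
  define f where "f x = std_normal_density x *\<^sub>R iexp (t * x)" for x
  have int_f: "integrable lborel f"
  proof (rule Bochner_Integration.integrable_bound)
    show "integrable lborel std_normal_density"
      by (rule integrable_normal_density) simp
    show "f \<in> borel_measurable lborel" unfolding f_def by measurable
  qed (auto simp: f_def)
  have "(\<integral>x. f x \<partial>lborel) = char std_normal_distribution t"
    unfolding char_def f_def
    by (subst integral_density) auto
  then have f_val: "(\<integral>x. f x \<partial>lborel) = exp (- (t^2) / 2)"
    by (simp add: char_std_normal_distribution)
  have fc: "f (- c * y + c * x) = (complex_of_real (1 / sqrt (2 * pi)) * exp (\<i> * complex_of_real (y * \<xi>))) *
     (complex_of_real (exp (- s * (x - y)^2)) * exp (- \<i> * complex_of_real (x * \<xi>)))" for x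
  proof -
    have 1: "(- c * y + c * x)\<^sup>2 = 2 * s * (x - y)^2"
      using c(2) by (metis (no_types, lifting) add.commute diff_conv_add_uminus minus_mult_left power_mult_distrib right_diff_distrib)
    have 2: "t * (- c * y + c * x) = y * \<xi> + - (x * \<xi>)"
      using c by (simp add: t_def field_simps)
    have "iexp (t * (- c * y + c * x)) = exp (\<i> * complex_of_real (y * \<xi>)) * exp (- \<i> * complex_of_real (x * \<xi>))"
      unfolding 2 by (simp add: exp_add[symmetric] algebra_simps)
    then show ?thesis
      unfolding f_def 1 std_normal_density_def by (simp add: scaleR_conv_of_real)
  qed
  let ?h = "\<lambda>x. complex_of_real (exp (- s * (x - y)^2)) * exp (- \<i> * complex_of_real (x * \<xi>))"
  let ?k = "complex_of_real (1 / sqrt (2 * pi)) * exp (\<i> * complex_of_real (y * \<xi>))"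
  have k0: "?k \<noteq> 0" by simp
  have "integrable lborel (\<lambda>x. f (- c * y + c * x))"
    using lborel_integrable_real_affine[OF int_f, of c "- c * y"] c(1) by blast
  then have "integrable lborel (\<lambda>x. inverse ?k * (?k * ?h x))"
    unfolding fc by (rule integrable_mult_right)
  moreover have "inverse k * (k * z) = z" if "k \<noteq> 0" for k z :: complex
    using that by simp
  from this[OF k0] have "(\<lambda>x. inverse ?k * (?k * ?h x)) = ?h"
    by (intro ext)
  ultimately have int_h: "integrable lborel ?h"
    by (simp only:)
  have "exp (- (t^2) / 2) = \<bar>c\<bar> *\<^sub>R (\<integral>x. f (- c * y + c * x) \<partial>lborel)"
    using lborel_integral_real_affine[of c f "- c * y"] c f_val by simp
  also have "\<dots> = c *\<^sub>R (?k * (\<integral>x. ?h x \<partial>lborel))"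
    unfolding fc using c by simp
  finally have "complex_of_real (exp (- (t^2) / 2)) = complex_of_real c * (?k * (\<integral>x. ?h x \<partial>lborel))"
    by (simp add: scaleR_conv_of_real)
  moreover have "t^2/2 = \<xi>^2 / (4 * s)"
    using c by (simp add: t_def power_divide)
  moreover have "exp (\<i> * complex_of_real (y * \<xi>)) * exp (- \<i> * complex_of_real (y * \<xi>)) = 1"
    by (simp add: exp_add[symmetric])
  moreover have "sqrt (2 * pi) / c = sqrt (pi / s)"
    by (simp add: c_def real_sqrt_divide[symmetric])
  ultimately have "(\<integral>x. ?h x \<partial>lborel) = complex_of_real (sqrt (2 * pi) / c * exp (- (\<xi>^2) / (4 * s))) * exp (- \<i> * complex_of_real (y * \<xi>))"
    using c(1) by (simp add: field_simps)
  then have "(\<integral>x. ?h x \<partial>lborel) = complex_of_real (sqrt (pi / s) * exp (- (\<xi>^2) / (4 * s))) * exp (- \<i> * complex_of_real (y * \<xi>))"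
    by (simp only: \<open>sqrt (2 * pi) / c = sqrt (pi / s)\<close>)
  then show ?thesis using int_h by (simp add: has_bochner_integral_iff)
qed

lemma has_bochner_integral_lborel_prod:
  fixes f :: "'a::euclidean_space \<Rightarrow> real \<Rightarrow> 'c::{real_normed_field,banach,second_countable_topology}"
  assumes f: "\<And>b. b \<in> Basis \<Longrightarrow> has_bochner_integral lborel (f b) (v b)"
  shows "has_bochner_integral lborel (\<lambda>x. \<Prod>b\<in>Basis. f b (x \<bullet> b)) (\<Prod>b\<in>Basis. v b)"
proof -
  interpret product_sigma_finite "\<lambda>_::'a. lborel :: real measure" ..
  have int: "integrable lborel (f b)" and val: "integral\<^sup>L lborel (f b) = v b" if "b \<in> Basis" for b
    using f[OF that] by (auto simp: has_bochner_integral_iff)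
  have [measurable]: "f b \<in> borel_measurable borel" if "b \<in> Basis" for b
    using borel_measurable_integrable[OF int[OF that]] by simp
  have m: "(\<lambda>x. \<Prod>b\<in>Basis. f b (x \<bullet> b)) \<in> borel_measurable (borel :: 'a measure)"
    by measurable
  have s: "(\<Sum>b\<in>Basis. g b *\<^sub>R b) \<bullet> c = g c" if "c \<in> Basis" for g :: "'a \<Rightarrow> real" and c
    using that by (simp add: inner_sum_left inner_Basis if_distrib sum.delta' cong: if_cong)
  have "integrable (Pi\<^sub>M (Basis :: 'a set) (\<lambda>_. lborel)) (\<lambda>x. \<Prod>b\<in>Basis. f b (x b))"
    using int by (intro product_integrable_prod) auto
  moreover have "(\<integral>x. (\<Prod>b\<in>Basis. f b (x b)) \<partial>Pi\<^sub>M (Basis :: 'a set) (\<lambda>_. lborel)) = (\<Prod>b\<in>Basis. v b)"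
    using int val by (subst product_integral_prod) auto
  ultimately show ?thesis
    unfolding lborel_eq[where 'a='a] has_bochner_integral_iff
    using m by (simp add: integrable_distr_eq integral_distr s del: of_real_prod)
qed

text \<open>
  Both the Gaussian and the character factor over the coordinates.
\<close>

lemma gaussian_fourier:
  fixes y \<xi> :: "'a::euclidean_space"
  assumes s: "s > 0"
  shows "has_bochner_integral lborel
     (\<lambda>x. complex_of_real (exp (- s * (norm (x - y))^2)) * exp (- \<i> * complex_of_real (x \<bullet> \<xi>)))
     (complex_of_real ((pi / s) powr (DIM('a) / 2) * exp (- ((norm \<xi>)^2) / (4 * s))) * exp (- \<i> * complex_of_real (y \<bullet> \<xi>)))"
proof -
  have n: "(norm z)^2 = (\<Sum>b\<in>Basis. (z \<bullet> b)^2)" for z :: 'a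
    unfolding power2_norm_eq_inner by (subst euclidean_inner) (simp add: power2_eq_square)
  have e: "exp (- \<i> * complex_of_real (z \<bullet> \<xi>)) = (\<Prod>b\<in>Basis. exp (- \<i> * complex_of_real ((z \<bullet> b) * (\<xi> \<bullet> b))))" for z
    by (subst euclidean_inner) (simp add: exp_sum sum_distrib_left flip: sum_negf)
  have 1: "complex_of_real (exp (- s * (norm (x - y))^2)) * exp (- \<i> * complex_of_real (x \<bullet> \<xi>)) =
     (\<Prod>b\<in>Basis. complex_of_real (exp (- s * (x \<bullet> b - y \<bullet> b)^2)) * exp (- \<i> * complex_of_real ((x \<bullet> b) * (\<xi> \<bullet> b))))" for x
    unfolding prod.distrib e[symmetric] n inner_diff_left
    by (simp add: exp_sum sum_distrib_left flip: sum_negf)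
  have "(\<Prod>b\<in>(Basis::'a set). sqrt (pi / s)) = (pi / s) powr (DIM('a) / 2)"
    using s by (simp add: powr_half_sqrt[symmetric] powr_power)
  then have 2: "complex_of_real ((pi / s) powr (DIM('a) / 2) * exp (- ((norm \<xi>)^2) / (4 * s))) * exp (- \<i> * complex_of_real (y \<bullet> \<xi>)) =
     (\<Prod>b\<in>Basis. complex_of_real (sqrt (pi / s) * exp (- ((\<xi> \<bullet> b)^2) / (4 * s))) * exp (- \<i> * complex_of_real ((y \<bullet> b) * (\<xi> \<bullet> b))))"
    unfolding prod.distrib e[symmetric] n
    by (simp add: prod.distrib exp_sum sum_divide_distrib flip: sum_negf of_real_prod of_real_power)
  show ?thesis
    unfolding 1 2
    by (rule has_bochner_integral_lborel_prod) (rule gaussian_fourier_real[OF s])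
qed

lemma gaussian_integral:
  assumes s: "s > 0"
  shows "(\<integral>\<^sup>+x. ennreal (exp (- s * (norm (x - y :: 'a::euclidean_space))^2)) \<partial>lborel) = ennreal ((pi / s) powr (DIM('a) / 2))"
proof -
  have "has_bochner_integral lborel (\<lambda>x. complex_of_real (exp (- s * (norm (x - y))^2))) (complex_of_real ((pi / s) powr (DIM('a) / 2)))"
    using gaussian_fourier[OF s, of y 0] by simp
  from has_bochner_integral_Re[OF this]
  have "has_bochner_integral lborel (\<lambda>x. (exp (- s * (norm (x - y))^2))) (((pi / s) powr (DIM('a) / 2)))"
    by simp
  then show ?thesis
    by (simp add: has_bochner_integral_iff nn_integral_eq_integral)
qed

text \<open>
  Write the power as a mixture of Gaussians and integrate in \<open>x\<close> first. What remains,
  \<open>exp (\<gamma> u / 2) * (pi / (1 + exp u)) powr (n / 2)\<close>, decays exponentially at \<open>- \<infinity>\<close> because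
  \<open>\<gamma> > 0\<close> and at \<open>\<infinity>\<close> because \<open>\<gamma> < n\<close>. The Gaussian factor makes the bound global.
\<close>

lemma powr_neg_norm_locally_integrable:
  fixes \<gamma> :: real
  assumes "0 < \<gamma>" "\<gamma> < DIM('a)"
  shows "(\<integral>\<^sup>+(x::'a::euclidean_space). ennreal (norm x powr (- \<gamma>) * exp (- ((norm x)^2))) \<partial>lborel) < \<infinity>"
proof -
  let ?n = "real DIM('a)"
  obtain G where G: "G > 0" "\<And>r. r > 0 \<Longrightarrow> (\<integral>\<^sup>+u. ennreal (exp (\<gamma>/2 * u - r * exp u)) \<partial>lborel) = ennreal (G * r powr (- (\<gamma>/2)))"
    using mellin_exp[of "\<gamma>/2"] assms by auto
  define d where "d = min (\<gamma>/2) ((?n - \<gamma>)/2)"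
  have d: "d > 0" "d \<le> \<gamma>/2" "d \<le> (?n - \<gamma>)/2" using assms by (auto simp: d_def min_def field_simps)
  have pt: "ennreal G * ennreal (norm x powr (- \<gamma>) * exp (- ((norm x)^2))) =
     (\<integral>\<^sup>+u. ennreal (exp (\<gamma>/2 * u)) * ennreal (exp (- (1 + exp u) * (norm x)^2)) \<partial>lborel)" if "x \<noteq> 0" for x :: 'a
  proof -
    have "(\<integral>\<^sup>+u. ennreal (exp (\<gamma>/2 * u)) * ennreal (exp (- (1 + exp u) * (norm x)^2)) \<partial>lborel) =
       (\<integral>\<^sup>+u. ennreal (exp (- ((norm x)^2))) * ennreal (exp (\<gamma>/2 * u - ((norm x)^2) * exp u)) \<partial>lborel)"
      by (intro nn_integral_cong) (simp add: ennreal_mult[symmetric] exp_add[symmetric] algebra_simps)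
    also have "\<dots> = ennreal (exp (- ((norm x)^2))) * ennreal (G * ((norm x)^2) powr (- (\<gamma>/2)))"
      using that by (subst nn_integral_cmult) (auto simp: G(2)[simplified])
    also have "((norm x)^2) powr (- (\<gamma>/2)) = norm x powr (- \<gamma>)"
      using that by (simp add: powr_powr flip: powr_numeral)
    finally show ?thesis using G(1) by (simp add: ennreal_mult[symmetric] mult_ac)
  qed
  have AE0: "AE x in (lborel :: 'a measure). x \<noteq> 0"
    by (rule AE_lborel_singleton)
  have "ennreal G * (\<integral>\<^sup>+(x::'a). ennreal (norm x powr (- \<gamma>) * exp (- ((norm x)^2))) \<partial>lborel)
    = (\<integral>\<^sup>+(x::'a). ennreal G * ennreal (norm x powr (- \<gamma>) * exp (- ((norm x)^2))) \<partial>lborel)"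
    by (rule nn_integral_cmult[symmetric]) auto
  also have "\<dots> = (\<integral>\<^sup>+(x::'a). (\<integral>\<^sup>+u. ennreal (exp (\<gamma>/2 * u)) * ennreal (exp (- (1 + exp u) * (norm x)^2)) \<partial>lborel) \<partial>lborel)"
    by (rule nn_integral_cong_AE, use AE0 in eventually_elim) (rule pt)
  also have "\<dots> = (\<integral>\<^sup>+u. (\<integral>\<^sup>+(x::'a). ennreal (exp (\<gamma>/2 * u)) * ennreal (exp (- (1 + exp u) * (norm x)^2)) \<partial>lborel) \<partial>lborel)"
    by (rule lborel_pair.Fubini') measurable
  also have "\<dots> = (\<integral>\<^sup>+u. ennreal (exp (\<gamma>/2 * u) * (pi / (1 + exp u)) powr (?n / 2)) \<partial>lborel)"
  proof (rule nn_integral_cong)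
    fix u :: real
    have p: "1 + exp u > 0" by (simp add: add_pos_pos)
    show "(\<integral>\<^sup>+(x::'a). ennreal (exp (\<gamma>/2 * u)) * ennreal (exp (- (1 + exp u) * (norm x)^2)) \<partial>lborel) =
       ennreal (exp (\<gamma>/2 * u) * (pi / (1 + exp u)) powr (?n / 2))"
      using gaussian_integral[OF p, of "0::'a"] by (subst nn_integral_cmult) (auto simp: ennreal_mult)
  qed
  also have "\<dots> \<le> (\<integral>\<^sup>+u. ennreal (pi powr (?n / 2)) * ennreal (exp (- d * \<bar>u\<bar>)) \<partial>lborel)"
  proof (rule nn_integral_mono, subst ennreal_mult[symmetric])
    fix u :: real
    have p: "1 + exp u > 0" by (simp add: add_pos_pos)
    have "exp (\<gamma>/2 * u) \<le> exp (- d * \<bar>u\<bar>) * (1 + exp u) powr (?n / 2)"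
    proof (cases "u \<le> 0")
      case True
      have "exp (\<gamma>/2 * u) \<le> exp (- d * \<bar>u\<bar>)"
        using True d mult_right_mono_neg[of d "\<gamma>/2" u] by simp
      also have "\<dots> \<le> exp (- d * \<bar>u\<bar>) * (1 + exp u) powr (?n / 2)"
        by (simp add: ge_one_powr_ge_zero)
      finally show ?thesis .
    next
      case False
      have "\<gamma>/2 * u \<le> - d * u + u * (?n/2)"
        using mult_right_mono[of d "(?n - \<gamma>)/2" u] d False by (simp add: field_simps)
      then have "exp (\<gamma>/2 * u) \<le> exp (- d * u) * exp u powr (?n/2)"
        by (simp add: powr_def exp_add[symmetric] mult.commute)
      also have "\<dots> \<le> exp (- d * u) * (1 + exp u) powr (?n/2)"
        by (intro mult_left_mono powr_mono2) auto
      finally show ?thesis using False by simp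
    qed
    then show "ennreal (exp (\<gamma>/2 * u) * (pi / (1 + exp u)) powr (?n / 2)) \<le> ennreal (pi powr (?n / 2) * exp (- d * \<bar>u\<bar>))"
      using p by (intro ennreal_leI) (simp add: powr_divide field_simps mult_left_mono)
  qed auto
  also have "\<dots> = ennreal (pi powr (?n / 2)) * (\<integral>\<^sup>+u. ennreal (exp (- d * \<bar>u\<bar>)) \<partial>lborel)"
    by (rule nn_integral_cmult) auto
  also have "\<dots> < \<infinity>"
    using nn_integral_exp_neg_finite[OF d(1)] by (simp add: ennreal_mult_less_top)
  finally show ?thesis
    using G(1) by (auto simp: ennreal_mult_less_top)
qed

text \<open>
  Fubini in the form used below: absolute integrability is checked by an iterated integral.
\<close>

lemma lborel_integral_swap:
  fixes F :: "'a::euclidean_space \<Rightarrow> 'b::euclidean_space \<Rightarrow> 'c::{banach,second_countable_topology}"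
  assumes m: "case_prod F \<in> borel_measurable (lborel \<Otimes>\<^sub>M lborel)"
    and fin: "(\<integral>\<^sup>+x. \<integral>\<^sup>+y. ennreal (norm (F x y)) \<partial>lborel \<partial>lborel) < \<infinity>"
  shows "(\<integral>x. \<integral>y. F x y \<partial>lborel \<partial>lborel) = (\<integral>y. \<integral>x. F x y \<partial>lborel \<partial>lborel)"
proof -
  have "(\<integral>\<^sup>+z. ennreal (norm (case_prod F z)) \<partial>(lborel \<Otimes>\<^sub>M lborel)) < \<infinity>"
    using fin m by (simp add: lborel.nn_integral_fst[symmetric])
  then have "integrable (lborel \<Otimes>\<^sub>M lborel) (case_prod F)"
    using m by (simp add: integrable_iff_bounded)
  from lborel_pair.Fubini_integral[OF this] show ?thesis by simp
qed

text \<open>For a non-integrable function the left-hand side is the default value 0.\<close>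

lemma norm_integral_le_nn_integral:
  fixes f :: "'a \<Rightarrow> 'b::{banach,second_countable_topology}"
  shows "ennreal (norm (integral\<^sup>L M f)) \<le> (\<integral>\<^sup>+x. ennreal (norm (f x)) \<partial>M)"
  by (cases "integrable M f") (simp_all add: integral_norm_bound_ennreal not_integrable_integral_eq)

section \<open>Test functions and their Fourier transforms\<close>

lemma smooth_differentiable: "smooth f \<Longrightarrow> f differentiable (at x)"
  unfolding smooth_def by (metis foldr.simps(1) id_apply)

lemma smooth_partial_deriv:
  assumes "smooth f" shows "smooth (partial_deriv i f)"
  unfolding smooth_def
proof (intro allI)
  fix "is" x
  have "foldr partial_deriv is (partial_deriv i f) = foldr partial_deriv (is @ [i]) f" by simp
  then show "foldr partial_deriv is (partial_deriv i f) differentiable (at x)"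
    using assms unfolding smooth_def by metis
qed

lemma smooth_continuous: "smooth f \<Longrightarrow> continuous_on UNIV f"
  using smooth_differentiable differentiable_imp_continuous_within by (metis continuous_at_imp_continuous_on)

lemma Cc_infty_smooth: "f \<in> Cc_infty \<Longrightarrow> smooth f"
  by (simp add: Cc_infty_def)

lemma Cc_infty_has_derivative: "f \<in> Cc_infty \<Longrightarrow> (f has_derivative frechet_derivative f (at x)) (at x)"
  using Cc_infty_smooth smooth_differentiable frechet_derivative_works by blast

lemma Cc_infty_partial_deriv:
  assumes f: "f \<in> Cc_infty" shows "partial_deriv i f \<in> Cc_infty"
proof -
  let ?S = "closure {x. f x \<noteq> 0}"
  have "partial_deriv i f x = 0" if "x \<notin> ?S" for x
  proof -
    have "((\<lambda>_. 0) has_derivative (\<lambda>_. 0)) (at x)" by simp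
    then have "(f has_derivative (\<lambda>_. 0)) (at x)"
    proof (rule has_derivative_transform_within_open)
      show "open (- ?S)" "x \<in> - ?S" using that by auto
      show "0 = f y" if "y \<in> - ?S" for y
        using that closure_subset[of "{x. f x \<noteq> 0}"] by auto
    qed
    then show ?thesis
      unfolding partial_deriv_def using frechet_derivative_at by metis
  qed
  then have "{x. partial_deriv i f x \<noteq> 0} \<subseteq> ?S" by blast
  then have "closure {x. partial_deriv i f x \<noteq> 0} \<subseteq> ?S"
    by (rule closure_minimal) simp
  moreover have "compact ?S" using f by (simp add: Cc_infty_def)
  ultimately have "compact (closure {x. partial_deriv i f x \<noteq> 0})"
    by (metis closed_closure compact_Int_closed inf.absorb_iff2)
  moreover have "smooth (partial_deriv i f)"
    by (rule smooth_partial_deriv[OF Cc_infty_smooth[OF f]])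
  ultimately show ?thesis by (simp add: Cc_infty_def)
qed

lemma Cc_infty_support:
  assumes f: "f \<in> Cc_infty"
  obtains R where "R > 0" "\<And>x. norm x > R \<Longrightarrow> f x = 0"
proof -
  have "bounded {x. f x \<noteq> 0}"
    using f closure_subset[of "{x. f x \<noteq> 0}"] by (auto simp: Cc_infty_def intro: bounded_subset compact_imp_bounded)
  then obtain R where "R > 0" "\<forall>x\<in>{x. f x \<noteq> 0}. norm x \<le> R" unfolding bounded_pos by blast
  then have "f x = 0" if "norm x > R" for x using that by force
  with that \<open>R > 0\<close> show ?thesis by blast
qed

lemma Cc_infty_bounded:
  fixes f :: "real^'n::finite \<Rightarrow> 'k::real_normed_vector"
  assumes f: "f \<in> Cc_infty"
  obtains B where "B > 0" "\<And>x. norm (f x) \<le> B"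
proof -
  obtain R where R: "R > 0" "\<And>x. norm x > R \<Longrightarrow> f x = 0" using Cc_infty_support[OF f] by blast
  have "compact (f ` cball 0 R)"
    using smooth_continuous[OF Cc_infty_smooth[OF f]] by (intro compact_continuous_image) (auto intro: continuous_on_subset)
  then obtain B where B: "B > 0" "\<forall>y\<in>f ` cball 0 R. norm y \<le> B"
    using compact_imp_bounded bounded_pos by metis
  have "norm (f x) \<le> B" for x
    using B R by (cases "norm x \<le> R") auto
  with that B(1) show ?thesis by blast
qed

lemma Cc_infty_measurable [measurable_dest]:
  "f \<in> Cc_infty \<Longrightarrow> f \<in> borel_measurable borel"
  by (intro borel_measurable_continuous_onI smooth_continuous Cc_infty_smooth)

lemma Cc_infty_norm_integrable:
  fixes f :: "real^'n::finite \<Rightarrow> 'k::real_normed_vector"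
  assumes f: "f \<in> Cc_infty" shows "integrable lborel (\<lambda>x. norm (f x))"
proof -
  obtain R where R: "R > 0" "\<And>x. norm x > R \<Longrightarrow> f x = 0" using Cc_infty_support[OF f] by blast
  have "integrable lborel (\<lambda>x. indicator (cball 0 R) x *\<^sub>R norm (f x))"
    using smooth_continuous[OF Cc_infty_smooth[OF f]]
    by (intro borel_integrable_compact continuous_on_norm) (auto intro: continuous_on_subset)
  also have "(\<lambda>x. indicator (cball 0 R) x *\<^sub>R norm (f x)) = (\<lambda>x. norm (f x))"
    using R(2) by (auto simp: indicator_def fun_eq_iff not_le)
  finally show ?thesis .
qed

lemma Cc_infty_integrable:
  fixes f :: "real^'n::finite \<Rightarrow> 'k::{banach,second_countable_topology}"
  assumes f: "f \<in> Cc_infty" shows "integrable lborel f"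
  using Cc_infty_norm_integrable[OF f] Cc_infty_measurable[OF f]
  by (simp add: integrable_norm_iff)

lemma Cc_infty_lipschitz:
  fixes f :: "real^'n::finite \<Rightarrow> 'k::real_normed_vector"
  assumes f: "f \<in> Cc_infty" and B: "\<And>x. norm (partial_deriv i f x) \<le> B" and h: "h > 0"
  shows "norm (f (x + h *\<^sub>R axis i 1) - f x) \<le> B * h"
proof -
  let ?e = "axis i (1::real)"
  have "norm (f (x + h *\<^sub>R ?e) - f (x + 0 *\<^sub>R ?e)) \<le> B * norm (h - 0)"
  proof (rule differentiable_bound[where S=UNIV and f = "\<lambda>t. f (x + t *\<^sub>R ?e)"
      and f' = "\<lambda>t s. s *\<^sub>R partial_deriv i f (x + t *\<^sub>R ?e)"])
    fix t :: real
    let ?D = "frechet_derivative f (at (x + t *\<^sub>R ?e))"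
    have D: "(f has_derivative ?D) (at (x + t *\<^sub>R ?e))" by (rule Cc_infty_has_derivative[OF f])
    have "((\<lambda>t. f (x + t *\<^sub>R ?e)) has_derivative (\<lambda>s. ?D (s *\<^sub>R ?e))) (at t)"
      by (rule has_derivative_compose[where f = "\<lambda>t. x + t *\<^sub>R ?e" and g = f, OF _ D]) (auto intro!: derivative_eq_intros)
    moreover have "?D (s *\<^sub>R ?e) = s *\<^sub>R partial_deriv i f (x + t *\<^sub>R ?e)" for s
      using D unfolding partial_deriv_def by (simp add: has_derivative_linear linear_scale)
    ultimately show "((\<lambda>t. f (x + t *\<^sub>R ?e)) has_derivative (\<lambda>s. s *\<^sub>R partial_deriv i f (x + t *\<^sub>R ?e))) (at t within UNIV)"
      by simp
    show "onorm (\<lambda>s. s *\<^sub>R partial_deriv i f (x + t *\<^sub>R ?e)) \<le> B"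
      using B by (intro onorm_le) (simp add: mult.commute[of B] mult_left_mono)
  qed auto
  then show ?thesis using h by simp
qed

text \<open>
  The sequence form of the partial derivative, suited to dominated convergence.
\<close>

lemma difference_quotient_tendsto:
  fixes f :: "real^'n::finite \<Rightarrow> 'k::real_normed_vector"
  assumes f: "f \<in> Cc_infty"
  shows "(\<lambda>m. (f (x + (1 / real (Suc m)) *\<^sub>R axis i 1) - f x) /\<^sub>R (1 / real (Suc m))) \<longlonglongrightarrow> partial_deriv i f x"
proof -
  let ?e = "axis i (1::real)" and ?D = "frechet_derivative f (at x)"
  let ?h = "\<lambda>m. 1 / real (Suc m)"
  have D: "bounded_linear ?D" "((\<lambda>h. norm (f (x + h) - f x - ?D h) / norm h) \<longlongrightarrow> 0) (at 0)"
    using Cc_infty_has_derivative[OF f, of x] unfolding has_derivative_at by auto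
  have "filterlim (\<lambda>m. ?h m *\<^sub>R ?e) (at 0) sequentially"
    unfolding filterlim_at
  proof (intro conjI)
    have "?h \<longlonglongrightarrow> 0" by (rule LIMSEQ_Suc) (rule lim_1_over_n)
    then show "(\<lambda>m. ?h m *\<^sub>R ?e) \<longlonglongrightarrow> 0" by (rule tendsto_scaleR[OF _ tendsto_const, where a=0, simplified])
  qed auto
  from filterlim_compose[OF D(2) this]
  have "(\<lambda>m. norm (f (x + ?h m *\<^sub>R ?e) - f x - ?D (?h m *\<^sub>R ?e)) / norm (?h m *\<^sub>R ?e)) \<longlonglongrightarrow> 0" .
  moreover have "norm (f (x + ?h m *\<^sub>R ?e) - f x - ?D (?h m *\<^sub>R ?e)) / norm (?h m *\<^sub>R ?e)
     = norm ((f (x + ?h m *\<^sub>R ?e) - f x) /\<^sub>R ?h m - partial_deriv i f x)" for m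
  proof -
    have p: "?h m > 0" by simp
    have "?D (?h m *\<^sub>R ?e) = ?h m *\<^sub>R partial_deriv i f x"
      using D(1) unfolding partial_deriv_def by (simp add: bounded_linear.linear linear_scale)
    then have "f (x + ?h m *\<^sub>R ?e) - f x - ?D (?h m *\<^sub>R ?e) = ?h m *\<^sub>R ((f (x + ?h m *\<^sub>R ?e) - f x) /\<^sub>R ?h m - partial_deriv i f x)"
      using p by (simp add: scaleR_diff_right)
    then have "norm (f (x + ?h m *\<^sub>R ?e) - f x - ?D (?h m *\<^sub>R ?e)) = ?h m * norm ((f (x + ?h m *\<^sub>R ?e) - f x) /\<^sub>R ?h m - partial_deriv i f x)"
      using p by (metis abs_of_pos norm_scaleR)
    moreover have "norm (?h m *\<^sub>R ?e) = ?h m" using p by simp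
    ultimately show ?thesis using p by simp
  qed
  ultimately have "(\<lambda>m. norm ((f (x + ?h m *\<^sub>R ?e) - f x) /\<^sub>R ?h m - partial_deriv i f x)) \<longlonglongrightarrow> 0"
    by simp
  then show ?thesis by (simp only: tendsto_norm_zero_iff LIM_zero_iff)
qed

lemma fourier_integrand_integrable:
  fixes f :: "real^'n::finite \<Rightarrow> complex"
  assumes "integrable lborel f"
  shows "integrable lborel (\<lambda>x. exp (- \<i> * complex_of_real (x \<bullet> \<xi>)) * f x)"
proof (rule Bochner_Integration.integrable_bound[OF assms])
  have [measurable]: "f \<in> borel_measurable borel" using borel_measurable_integrable[OF assms] by simp
  show "(\<lambda>x. exp (- \<i> * complex_of_real (x \<bullet> \<xi>)) * f x) \<in> borel_measurable lborel" by measurable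
qed (simp add: norm_mult)

lemma fourier_measurable [measurable]:
  assumes "f \<in> borel_measurable borel" shows "fourier f \<in> borel_measurable borel"
proof -
  have [measurable]: "f \<in> borel_measurable lborel" using assms by simp
  show ?thesis unfolding fourier_def[abs_def]
    by (rule lborel.borel_measurable_lebesgue_integral) (use assms in measurable)
qed

lemma fourier_bound:
  fixes f :: "real^'n::finite \<Rightarrow> complex"
  shows "norm (fourier f \<xi>) \<le> (\<integral>x. norm (f x) \<partial>lborel)"
  unfolding fourier_def by (rule order_trans[OF integral_norm_bound]) (simp add: norm_mult)

lemma fourier_shift:
  fixes f :: "real^'n::finite \<Rightarrow> complex"
  assumes [measurable]: "f \<in> borel_measurable borel"
  shows "fourier (\<lambda>x. f (x + v)) \<xi> = exp (\<i> * complex_of_real (v \<bullet> \<xi>)) * fourier f \<xi>"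
proof -
  have "fourier f \<xi> = (\<integral>x. exp (- \<i> * complex_of_real (x \<bullet> \<xi>)) * f x \<partial>distr lborel borel ((+) v))"
    by (simp add: fourier_def lborel_distr_plus)
  also have "\<dots> = (\<integral>x. exp (- \<i> * complex_of_real ((v + x) \<bullet> \<xi>)) * f (v + x) \<partial>lborel)"
    by (rule integral_distr) measurable
  also have "\<dots> = (\<integral>x. exp (- \<i> * complex_of_real (v \<bullet> \<xi>)) * (exp (- \<i> * complex_of_real (x \<bullet> \<xi>)) * f (x + v)) \<partial>lborel)"
    by (intro Bochner_Integration.integral_cong refl) (simp add: inner_add_left exp_add[symmetric] algebra_simps exp_diff)
  also have "\<dots> = exp (- \<i> * complex_of_real (v \<bullet> \<xi>)) * fourier (\<lambda>x. f (x + v)) \<xi>"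
    unfolding fourier_def by (rule integral_mult_right_zero)
  finally show ?thesis by (simp add: exp_minus field_simps)
qed

text \<open>
  A difference quotient of \<open>f\<close> in direction \<open>i\<close> has Fourier transform
  \<open>(exp (\<i> h \<xi>\<^sub>i) - 1) / h\<close> times that of \<open>f\<close>, by translation invariance. Letting \<open>h\<close> tend to 0
  gives the claim; the quotients are dominated by the Lipschitz constant on a fixed ball. This
  takes the place of an integration by parts.
\<close>

lemma fourier_partial_deriv:
  fixes f :: "real^'n::finite \<Rightarrow> complex"
  assumes f: "f \<in> Cc_infty"
  shows "fourier (partial_deriv i f) \<xi> = \<i> * complex_of_real (\<xi> $ i) * fourier f \<xi>"
proof -
  let ?e = "axis i (1::real)"
  let ?h = "\<lambda>m. 1 / real (Suc m)"
  let ?E = "\<lambda>x. exp (- \<i> * complex_of_real (x \<bullet> \<xi>))"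
  let ?Q = "\<lambda>m x. (f (x + ?h m *\<^sub>R ?e) - f x) /\<^sub>R ?h m"
  note df = Cc_infty_partial_deriv[OF f, of i]
  have [measurable]: "f \<in> borel_measurable borel" "partial_deriv i f \<in> borel_measurable borel"
    using f df Cc_infty_measurable by blast+
  obtain B where B: "B > 0" "\<And>x. norm (partial_deriv i f x) \<le> B" using Cc_infty_bounded[OF df] by blast
  obtain R where R: "R > 0" "\<And>x. norm x > R \<Longrightarrow> f x = 0" using Cc_infty_support[OF f] by blast
  have h: "0 < ?h m" "?h m \<le> 1" for m by auto
  \<comment> \<open>The radius is enlarged by 1 because the steps are at most 1.\<close>
  have dom: "norm (?Q m x) \<le> B * indicator (cball 0 (R + 1)) x" for m x
  proof (cases "norm x \<le> R + 1")
    case True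
    have "norm (?Q m x) = inverse (?h m) * norm (f (x + ?h m *\<^sub>R ?e) - f x)"
      using h(1)[of m] by (simp only: norm_scaleR abs_inverse abs_of_pos)
    also have "\<dots> \<le> inverse (?h m) * (B * ?h m)"
      using Cc_infty_lipschitz[OF f B(2) h(1), of x m] h(1)[of m]
      by (intro mult_left_mono) auto
    finally show ?thesis using True h(1)[of m] by simp
  next
    case False
    have "norm x \<le> norm (x + ?h m *\<^sub>R ?e) + norm (?h m *\<^sub>R ?e)"
      by (metis add_diff_cancel_right' norm_triangle_ineq4)
    moreover have "norm (?h m *\<^sub>R ?e) \<le> 1" using h[of m] by simp
    ultimately have "norm (x + ?h m *\<^sub>R ?e) > R" "norm x > R" using False by linarith+
    then show ?thesis using R(2) B(1) by simp
  qed
  have "(\<lambda>m. \<integral>x. ?E x * ?Q m x \<partial>lborel) \<longlonglongrightarrow> (\<integral>x. ?E x * partial_deriv i f x \<partial>lborel)"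
  proof (rule integral_dominated_convergence[where w = "\<lambda>x. B * indicator (cball 0 (R + 1)) x"])
    show "integrable lborel (\<lambda>x. B * indicator (cball 0 (R + 1)) x :: real)"
      by (intro integrable_mult_right integrable_real_indicator) (simp_all add: emeasure_bounded_finite[unfolded infinity_ennreal_def])
    show "AE x in lborel. (\<lambda>m. ?E x * ?Q m x) \<longlonglongrightarrow> ?E x * partial_deriv i f x"
      by (intro AE_I2 tendsto_mult_left difference_quotient_tendsto f)
    show "AE x in lborel. norm (?E x * ?Q m x) \<le> B * indicator (cball 0 (R + 1)) x" for m
      using dom by (simp add: norm_mult)
  qed measurable
  moreover have "(\<integral>x. ?E x * ?Q m x \<partial>lborel) = ((exp (\<i> * complex_of_real (?h m * \<xi> $ i)) - 1) / complex_of_real (?h m)) * fourier f \<xi>" for m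
  proof -
    have int1: "integrable lborel (\<lambda>x. ?E x * f x)"
      by (rule fourier_integrand_integrable[OF Cc_infty_integrable[OF f]])
    have "integrable lborel (\<lambda>x. f (?h m *\<^sub>R ?e + x))"
      using Cc_infty_integrable[OF f] integrable_distr_eq[of "(+) (?h m *\<^sub>R ?e)" lborel borel f]
      by (simp add: lborel_distr_plus del: of_nat_Suc)
    then have int2: "integrable lborel (\<lambda>x. ?E x * f (x + ?h m *\<^sub>R ?e))"
      by (intro fourier_integrand_integrable) (simp add: add.commute)
    have "(\<integral>x. ?E x * ?Q m x \<partial>lborel) = (\<integral>x. (?E x * f (x + ?h m *\<^sub>R ?e) - ?E x * f x) / complex_of_real (?h m) \<partial>lborel)"
      by (intro Bochner_Integration.integral_cong refl) (simp add: scaleR_conv_of_real field_simps)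
    also have "\<dots> = (fourier (\<lambda>x. f (x + ?h m *\<^sub>R ?e)) \<xi> - fourier f \<xi>) / complex_of_real (?h m)"
      unfolding fourier_def integral_divide_zero
      by (subst Bochner_Integration.integral_diff[OF int2 int1]) simp
    also have "fourier (\<lambda>x. f (x + ?h m *\<^sub>R ?e)) \<xi> = exp (\<i> * complex_of_real (?h m * \<xi> $ i)) * fourier f \<xi>"
      by (subst fourier_shift) (auto simp: inner_axis')
    finally show ?thesis by (simp add: field_simps)
  qed
  ultimately have 1: "(\<lambda>m. ((exp (\<i> * complex_of_real (?h m * \<xi> $ i)) - 1) / complex_of_real (?h m)) * fourier f \<xi>) \<longlonglongrightarrow> fourier (partial_deriv i f) \<xi>"
    by (simp add: fourier_def)
  have "((\<lambda>z. exp (\<i> * complex_of_real (\<xi> $ i) * z)) has_field_derivative \<i> * complex_of_real (\<xi> $ i)) (at 0)"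
    by (auto intro!: derivative_eq_intros)
  then have "((\<lambda>z. (exp (\<i> * complex_of_real (\<xi> $ i) * z) - 1) / z) \<longlongrightarrow> \<i> * complex_of_real (\<xi> $ i)) (at 0)"
    unfolding DERIV_def by simp
  moreover have "filterlim (\<lambda>m. complex_of_real (?h m)) (at 0) sequentially"
    unfolding filterlim_at
  proof (intro conjI)
    have "?h \<longlonglongrightarrow> 0" by (rule LIMSEQ_Suc) (rule lim_1_over_n)
    from tendsto_of_real[OF this, where 'a = complex] show "(\<lambda>m. complex_of_real (?h m)) \<longlonglongrightarrow> 0"
      by (simp only: of_real_0)
  qed (auto simp del: of_nat_Suc)
  ultimately have "(\<lambda>m. (exp (\<i> * complex_of_real (\<xi> $ i) * complex_of_real (?h m)) - 1) / complex_of_real (?h m)) \<longlonglongrightarrow> \<i> * complex_of_real (\<xi> $ i)"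
    by (rule filterlim_compose)
  then have "(\<lambda>m. ((exp (\<i> * complex_of_real (?h m * \<xi> $ i)) - 1) / complex_of_real (?h m)) * fourier f \<xi>) \<longlonglongrightarrow> \<i> * complex_of_real (\<xi> $ i) * fourier f \<xi>"
    by (intro tendsto_mult_right) (simp add: mult_ac)
  with 1 show ?thesis by (rule LIMSEQ_unique)
qed

text \<open>
  By \<open>fourier_partial_deriv\<close>, multiplying the transform of \<open>f\<close> by \<open>1 + \<xi>\<^sub>j\<^sup>2\<close> gives the transform
  of \<open>f\<close> minus its second derivative in direction \<open>j\<close>, so one factor after the other can be absorbed.
\<close>

lemma fourier_decay:
  fixes f :: "real^'n::finite \<Rightarrow> complex"
  assumes "f \<in> Cc_infty"
  shows "\<exists>B. \<forall>\<xi>. (\<Prod>j\<leftarrow>js. 1 + (\<xi> $ j)^2) * norm (fourier f \<xi>) \<le> B"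
  using assms
proof (induction js arbitrary: f)
  case Nil
  show ?case using fourier_bound[of f] by auto
next
  case (Cons j js)
  let ?g = "partial_deriv j (partial_deriv j f)"
  have g: "?g \<in> Cc_infty" using Cons.prems by (intro Cc_infty_partial_deriv)
  obtain B1 where B1: "\<And>\<xi>. (\<Prod>j\<leftarrow>js. 1 + (\<xi> $ j)^2) * norm (fourier f \<xi>) \<le> B1"
    using Cons.IH[OF Cons.prems] by blast
  obtain B2 where B2: "\<And>\<xi>. (\<Prod>j\<leftarrow>js. 1 + (\<xi> $ j)^2) * norm (fourier ?g \<xi>) \<le> B2"
    using Cons.IH[OF g] by blast
  have "norm (fourier ?g \<xi>) = (\<xi> $ j)^2 * norm (fourier f \<xi>)" for \<xi>
    using Cons.prems by (simp add: fourier_partial_deriv Cc_infty_partial_deriv norm_mult power2_eq_square)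
  then have "(\<Prod>j\<leftarrow>(j#js). 1 + (\<xi> $ j)^2) * norm (fourier f \<xi>) \<le> B1 + B2" for \<xi>
    using B1[of \<xi>] B2[of \<xi>] by (simp add: algebra_simps)
  then show ?case by blast
qed

text \<open>
  Use the decay estimate once for every coordinate: the product of the functions
  \<open>1 / (1 + \<xi>\<^sub>j\<^sup>2)\<close> is integrable.
\<close>

lemma fourier_integrable:
  fixes f :: "real^'n::finite \<Rightarrow> complex"
  assumes f: "f \<in> Cc_infty"
  shows "integrable lborel (fourier f)"
proof -
  obtain js where js: "set js = (UNIV :: 'n set)" "distinct js"
    using finite_distinct_list[OF finite_class.finite_UNIV] by blast
  have [measurable]: "f \<in> borel_measurable borel" using f Cc_infty_measurable by blast
  have prod: "(\<Prod>j\<leftarrow>js. 1 + (\<xi> $ j)^2) = (\<Prod>b\<in>Basis. 1 + (\<xi> \<bullet> b)^2)" for \<xi> :: "real^'n"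
  proof -
    have "(\<Prod>j\<leftarrow>js. 1 + (\<xi> $ j)^2) = (\<Prod>j\<in>UNIV. 1 + (\<xi> $ j)^2)"
      using js by (metis prod.distinct_set_conv_list)
    also have "\<dots> = (\<Prod>b\<in>(\<lambda>j. axis j 1) ` UNIV. 1 + (\<xi> \<bullet> b)^2)"
      by (subst prod.reindex) (auto simp: inj_on_def axis_eq_axis cart_eq_inner_axis)
    also have "(\<lambda>j. axis j 1) ` UNIV = (Basis :: (real^'n) set)"
      by (auto simp: Basis_vec_def)
    finally show ?thesis .
  qed
  obtain B where B: "\<And>\<xi>. (\<Prod>b\<in>Basis. 1 + (\<xi> \<bullet> b)^2) * norm (fourier f \<xi>) \<le> B"
    using fourier_decay[OF f, of js] unfolding prod by blast
  have "integrable lborel (\<lambda>x::real. inverse (1 + x^2))"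
    using integrable_inverse_1_plus_square by (simp add: set_integrable_def)
  then have "has_bochner_integral lborel (\<lambda>x::real. inverse (1 + x^2)) (\<integral>x. inverse (1 + x^2) \<partial>lborel)"
    by (rule has_bochner_integral_integrable)
  then have "has_bochner_integral lborel (\<lambda>\<xi>::real^'n. \<Prod>b\<in>Basis. inverse (1 + (\<xi> \<bullet> b)^2)) (\<Prod>b\<in>(Basis::(real^'n) set). \<integral>x. inverse (1 + x^2) \<partial>lborel)"
    by (intro has_bochner_integral_lborel_prod)
  then have "integrable lborel (\<lambda>\<xi>::real^'n. B * (\<Prod>b\<in>Basis. inverse (1 + (\<xi> \<bullet> b)^2)))"
    by (intro integrable_mult_right) (simp add: has_bochner_integral_iff)
  then show ?thesis
  proof (rule Bochner_Integration.integrable_bound)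
    have "norm (fourier f \<xi>) \<le> B * (\<Prod>b\<in>Basis. inverse (1 + (\<xi> \<bullet> b)^2))" for \<xi>
    proof -
      have "(\<Prod>b\<in>Basis. 1 + (\<xi> \<bullet> b)^2) > 0" by (intro prod_pos) (auto simp: add_pos_nonneg)
      then show ?thesis using B[of \<xi>] by (simp only: prod_inversef[unfolded comp_def]) (simp add: field_simps)
    qed
    then show "AE \<xi> in lborel. norm (fourier f \<xi>) \<le> norm (B * (\<Prod>b\<in>Basis. inverse (1 + (\<xi> \<bullet> b)^2)))"
      by (intro AE_I2) (smt (verit) real_norm_def)
  qed measurable
qed

section \<open>The normalizing constant of the Riesz potential\<close>

text \<open>
  The potential of a bounded integrable function is bounded. Within distance 1 the kernel is at
  most \<open>exp 1\<close> times its integrable Gaussian truncation, and beyond that it is at most 1.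
\<close>

lemma powr_potential_bound:
  fixes \<gamma> :: real
  assumes \<gamma>: "0 < \<gamma>" "\<gamma> < DIM('a)"
  obtains W where "\<And>B (g::'a::euclidean_space \<Rightarrow> real) x. B \<ge> 0 \<Longrightarrow> g \<in> borel_measurable borel \<Longrightarrow> (\<And>y. 0 \<le> g y \<and> g y \<le> B) \<Longrightarrow>
     (\<integral>\<^sup>+y. ennreal (norm (x - y) powr (- \<gamma>) * g y) \<partial>lborel) \<le> ennreal (B * W) + (\<integral>\<^sup>+y. ennreal (g y) \<partial>lborel)"
proof -
  define k where "k z = norm z powr (- \<gamma>) * exp (- ((norm z)^2))" for z :: 'a
  have k[measurable]: "k \<in> borel_measurable borel" unfolding k_def by measurable
  have k0: "k z \<ge> 0" for z by (simp add: k_def)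
  have "(\<integral>\<^sup>+z. ennreal (k z) \<partial>lborel) < \<infinity>"
    unfolding k_def using powr_neg_norm_locally_integrable[OF \<gamma>] by simp
  then obtain W where W: "W \<ge> 0" "(\<integral>\<^sup>+z. ennreal (k z) \<partial>lborel) = ennreal W"
    by (cases "(\<integral>\<^sup>+z. ennreal (k z) \<partial>lborel)") auto
  have tr: "(\<integral>\<^sup>+y. ennreal (k (x - y)) \<partial>lborel) = ennreal W" for x
  proof -
    have "(\<integral>\<^sup>+z. ennreal (k z) \<partial>lborel) = (\<integral>\<^sup>+z. ennreal (k z) \<partial>distr lborel borel ((+) (-x)))"
      by (simp add: lborel_distr_plus)
    also have "\<dots> = (\<integral>\<^sup>+y. ennreal (k (- x + y)) \<partial>lborel)"
      by (rule nn_integral_distr) measurable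
    also have "\<dots> = (\<integral>\<^sup>+y. ennreal (k (x - y)) \<partial>lborel)"
      by (simp add: k_def norm_minus_commute)
    finally show ?thesis using W by simp
  qed
  have pt: "norm z powr (- \<gamma>) \<le> exp 1 * k z + 1" for z
  proof (cases "norm z \<le> 1")
    case True
    then have "(norm z)^2 \<le> 1" by (simp add: power_le_one)
    then have "1 \<le> exp 1 * exp (- ((norm z)^2))" by (simp add: exp_add[symmetric])
    then have "norm z powr (- \<gamma>) * 1 \<le> norm z powr (- \<gamma>) * (exp 1 * exp (- ((norm z)^2)))"
      by (intro mult_left_mono) auto
    then show ?thesis by (simp add: k_def mult_ac)
  next
    case False
    then have "norm z powr (- \<gamma>) \<le> norm z powr 0" using \<gamma> by (intro powr_mono) auto
    moreover have "norm z \<noteq> 0" using False by auto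
    moreover have "exp 1 * k z \<ge> 0" using k0[of z] by simp
    ultimately show ?thesis by simp
  qed
  have "(\<integral>\<^sup>+y. ennreal (norm (x - y) powr (- \<gamma>) * g y) \<partial>lborel) \<le> ennreal (B * (exp 1 * W)) + (\<integral>\<^sup>+y. ennreal (g y) \<partial>lborel)"
    if B: "B \<ge> 0" and g[measurable]: "g \<in> borel_measurable borel" and gB: "\<And>y. 0 \<le> g y \<and> g y \<le> B" for B and g :: "'a \<Rightarrow> real" and x
  proof -
    have "(\<integral>\<^sup>+y. ennreal (norm (x - y) powr (- \<gamma>) * g y) \<partial>lborel) \<le> (\<integral>\<^sup>+y. ennreal (B * exp 1) * ennreal (k (x - y)) + ennreal (g y) \<partial>lborel)"
    proof (rule nn_integral_mono)
      fix y
      have g: "0 \<le> g y" "g y \<le> B" using gB by auto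
      have "norm (x - y) powr (- \<gamma>) * g y \<le> (exp 1 * k (x - y) + 1) * g y"
        using g pt by (intro mult_right_mono) auto
      also have "\<dots> = (exp 1 * k (x - y)) * g y + g y" by (simp add: algebra_simps)
      also have "\<dots> \<le> (exp 1 * k (x - y)) * B + g y"
        using g k0 by (intro add_right_mono mult_left_mono) auto
      finally show "ennreal (norm (x - y) powr (- \<gamma>) * g y) \<le> ennreal (B * exp 1) * ennreal (k (x - y)) + ennreal (g y)"
        using g k0 B by (simp add: ennreal_mult[symmetric] ennreal_plus[symmetric] mult_ac del: ennreal_plus)
    qed
    also have "\<dots> = ennreal (B * exp 1) * ennreal W + (\<integral>\<^sup>+y. ennreal (g y) \<partial>lborel)"
      by (subst nn_integral_add) (auto simp: nn_integral_cmult tr)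
    finally show ?thesis using B W by (simp add: ennreal_mult[symmetric] mult.assoc)
  qed
  then show thesis by (rule that)
qed

text \<open>
  Let \<open>E u x y = exp (\<gamma> u / 2 - \<bar>x - y\<bar>\<^sup>2 exp u)\<close> with \<open>\<gamma> = n - \<alpha>\<close>. Its integral over \<open>u\<close> is
  \<open>Ga\<close> times the Riesz kernel (\<open>int_E\<close>). Its Fourier transform in \<open>x\<close> is \<open>m u \<xi>\<close> times a character
  (\<open>gauss\<close>), and the integral of \<open>m u \<xi>\<close> over \<open>u\<close> is a constant times \<open>\<bar>\<xi>\<bar> powr (- \<alpha>)\<close> (\<open>int_m\<close>).
  The required identity follows by writing the potential of \<open>g\<close> as the integral over \<open>u\<close> of the
  convolutions \<open>h u\<close> of \<open>g\<close> with these Gaussians, for which it is Fubini's theorem. The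
  constant \<open>c\<close> is the quotient of the two constants.
\<close>

lemma riesz_normalizes_exists:
  fixes \<alpha> :: real
  assumes \<alpha>: "0 < \<alpha>" "\<alpha> < real CARD('n)"
  shows "\<exists>c>0. riesz_normalizes TYPE('n::finite) \<alpha> c"
proof -
  let ?n = "real CARD('n)"
  define \<gamma> where "\<gamma> = ?n - \<alpha>"
  have \<gamma>: "0 < \<gamma>" "\<gamma> < ?n" using \<alpha> by (auto simp: \<gamma>_def)
  obtain Ga where Ga: "Ga > 0" "\<And>r. r > 0 \<Longrightarrow> (\<integral>\<^sup>+u. ennreal (exp (\<gamma>/2 * u - r * exp u)) \<partial>lborel) = ennreal (Ga * r powr (- (\<gamma>/2)))"
    using mellin_exp[of "\<gamma>/2"] \<gamma> by auto
  obtain Gb where Gb: "Gb > 0" "\<And>r. r > 0 \<Longrightarrow> (\<integral>\<^sup>+u. ennreal (exp (\<alpha>/2 * u - r * exp u)) \<partial>lborel) = ennreal (Gb * r powr (- (\<alpha>/2)))"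
    using mellin_exp[of "\<alpha>/2"] \<alpha> by auto
  define E where "E u x y = exp (\<gamma>/2 * u - (norm (x - y))^2 * exp u)" for u :: real and x y :: "real^'n"
  define k where "k x y = 1 / norm (x - y) powr \<gamma>" for x y :: "real^'n"
  define p where "p = pi powr (?n/2)"
  define m where "m u \<xi> = p * exp (- (\<alpha>/2) * u - ((norm \<xi>)^2 / 4) * exp (- u))" for u :: real and \<xi> :: "real^'n"
  define c where "c = Ga / (p * 4 powr (\<alpha>/2) * Gb)"
  have p: "p > 0" by (simp add: p_def)
  have c: "c > 0" using Ga Gb p by (simp add: c_def)
  have [measurable]: "(\<lambda>(u, y). E u x y) \<in> borel_measurable (borel \<Otimes>\<^sub>M borel)" for x
    unfolding E_def by measurable
  have [measurable]: "(\<lambda>z. E u (f z) (h z)) \<in> borel_measurable M" if [measurable]: "f \<in> borel_measurable M" "h \<in> borel_measurable M" for M :: "'z measure" and f h u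
    unfolding E_def by measurable
  have E0: "E u x y > 0" for u x y by (simp add: E_def)
  have k0: "k x y \<ge> 0" for x y by (simp add: k_def)
  have int_E: "(\<integral>\<^sup>+u. ennreal (E u x y) \<partial>lborel) = ennreal (Ga * k x y)" if "x \<noteq> y" for x y
  proof -
    have "(\<integral>\<^sup>+u. ennreal (E u x y) \<partial>lborel) = ennreal (Ga * ((norm (x - y))^2) powr (- (\<gamma>/2)))"
      unfolding E_def using that by (intro Ga(2)) simp
    also have "((norm (x - y))^2) powr (- (\<gamma>/2)) = k x y"
      using that by (simp add: k_def powr_powr powr_minus_divide flip: powr_numeral)
    finally show ?thesis .
  qed
  have gauss: "has_bochner_integral lborel (\<lambda>x. complex_of_real (E u x y) * exp (- \<i> * complex_of_real (x \<bullet> \<xi>)))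
      (complex_of_real (m u \<xi>) * exp (- \<i> * complex_of_real (y \<bullet> \<xi>)))" for u y \<xi>
  proof -
    have s: "exp u > 0" by simp
    have 1: "complex_of_real (exp (\<gamma>/2 * u)) * (complex_of_real (exp (- exp u * (norm (x - y))^2)) * z) = complex_of_real (E u x y) * z" for x z
      by (simp add: E_def exp_add[symmetric] flip: of_real_mult mult.assoc)
    have "(pi / exp u) powr (?n/2) = p * exp (- (?n/2) * u)"
      by (simp add: p_def powr_def ln_div exp_add[symmetric] field_simps)
    moreover have "exp (\<gamma>/2 * u) * exp (- (?n/2) * u) = exp (- (\<alpha>/2) * u)"
      unfolding exp_add[symmetric] by (rule arg_cong[where f=exp]) (simp add: \<gamma>_def field_simps)
    moreover have "- ((norm \<xi>)^2) / (4 * exp u) = - ((norm \<xi>)^2 / 4 * exp (- u))"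
      by (simp add: exp_minus field_simps)
    moreover have "m u \<xi> = p * (exp (- (\<alpha>/2) * u) * exp (- ((norm \<xi>)^2 / 4 * exp (- u))))"
      unfolding m_def exp_add[symmetric] by simp
    ultimately have "exp (\<gamma>/2 * u) * ((pi / exp u) powr (?n/2) * exp (- ((norm \<xi>)^2) / (4 * exp u))) = m u \<xi>"
      by (metis (no_types, opaque_lifting) mult.assoc mult.left_commute)
    then have 2: "complex_of_real (exp (\<gamma>/2 * u)) * (complex_of_real ((pi / exp u) powr (?n/2) * exp (- ((norm \<xi>)^2) / (4 * exp u))) * z) = complex_of_real (m u \<xi>) * z" for z
      by (metis mult.assoc of_real_mult)
    show ?thesis
      using has_bochner_integral_mult_right[OF gaussian_fourier[OF s, of y \<xi>], of "complex_of_real (exp (\<gamma>/2 * u))"]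
      by (simp only: 1 2 DIM_cart DIM_real mult_1_right)
  qed
  have int_m: "(\<integral>\<^sup>+u. ennreal (m u \<xi>) \<partial>lborel) = ennreal (p * 4 powr (\<alpha>/2) * Gb * norm \<xi> powr (- \<alpha>))" if "\<xi> \<noteq> 0" for \<xi>
  proof -
    have "(\<integral>\<^sup>+u. ennreal (m u \<xi>) \<partial>lborel) = ennreal p * (\<integral>\<^sup>+u. ennreal (exp (- (\<alpha>/2) * u - ((norm \<xi>)^2 / 4) * exp (- u))) \<partial>lborel)"
      unfolding m_def using p by (subst nn_integral_cmult[symmetric]) (auto simp: ennreal_mult)
    also have "\<dots> = ennreal p * ennreal (Gb * ((norm \<xi>)^2 / 4) powr (- (\<alpha>/2)))"
      unfolding mellin_exp_reflected using that by (subst Gb(2)) auto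
    also have "((norm \<xi>)^2 / 4) powr (- (\<alpha>/2)) = 4 powr (\<alpha>/2) * norm \<xi> powr (- \<alpha>)"
      using that by (simp add: powr_divide powr_powr powr_minus_divide flip: powr_numeral)
    finally show ?thesis using p Gb by (simp add: ennreal_mult[symmetric] mult_ac)
  qed
  have m0: "m u \<xi> > 0" for u \<xi> using p by (simp add: m_def)
  have [measurable]: "(\<lambda>(u, \<xi>). m u \<xi>) \<in> borel_measurable (borel \<Otimes>\<^sub>M borel)" "m u \<in> borel_measurable borel" for u
    unfolding m_def by measurable
  have "riesz_normalizes TYPE('n) \<alpha> c"
    unfolding riesz_normalizes_def
  proof (intro ballI)
    fix g \<phi> :: "real^'n \<Rightarrow> complex"
    assume g: "g \<in> Cc_infty" and \<phi>: "\<phi> \<in> Cc_infty"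
    have gm[measurable]: "g \<in> borel_measurable borel" and \<phi>m[measurable]: "\<phi> \<in> borel_measurable borel"
      using g \<phi> Cc_infty_measurable by blast+
    have [measurable]: "fourier g \<in> borel_measurable borel" "fourier \<phi> \<in> borel_measurable borel"
      by measurable
    note ig = Cc_infty_integrable[OF g] and i\<phi> = Cc_infty_integrable[OF \<phi>]
    define h where "h u x = (\<integral>y. E u x y *\<^sub>R g y \<partial>lborel)" for u x
    have E_uy[measurable]: "(\<lambda>z. E (fst (fst z)) (snd (fst z)) (snd z)) \<in> borel_measurable ((borel \<Otimes>\<^sub>M borel) \<Otimes>\<^sub>M borel)"
      unfolding E_def by measurable
    have hm: "(\<lambda>z. h (fst z) (snd z)) \<in> borel_measurable (borel \<Otimes>\<^sub>M borel)"
      unfolding h_def by (rule lborel.borel_measurable_lebesgue_integral) (simp add: split_beta', measurable)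
    have [measurable]: "(\<lambda>z. h (a z) (b z)) \<in> borel_measurable M" if "a \<in> borel_measurable M" "b \<in> borel_measurable M" for a b and M :: "'z measure"
      using measurable_compose[OF measurable_Pair[OF that] hm] by simp
    obtain B where B: "B > 0" "\<And>x. norm (g x) \<le> B" using Cc_infty_bounded[OF g] by blast
    have "\<gamma> < DIM(real^'n)" using \<gamma> by simp
    obtain W where "\<And>B (q::real^'n \<Rightarrow> real) x. B \<ge> 0 \<Longrightarrow> q \<in> borel_measurable borel \<Longrightarrow> (\<And>y. 0 \<le> q y \<and> q y \<le> B) \<Longrightarrow>
       (\<integral>\<^sup>+y. ennreal (norm (x - y) powr (- \<gamma>) * q y) \<partial>lborel) \<le> ennreal (B * W) + (\<integral>\<^sup>+y. ennreal (q y) \<partial>lborel)"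
      by (rule powr_potential_bound[OF \<gamma>(1) \<open>\<gamma> < DIM(real^'n)\<close>], erule that)
    from this[of B "\<lambda>y. norm (g y)"]
    have W: "(\<integral>\<^sup>+y. ennreal (norm (x - y) powr (- \<gamma>) * norm (g y)) \<partial>lborel) \<le> ennreal (B * W) + (\<integral>\<^sup>+y. ennreal (norm (g y)) \<partial>lborel)" for x
      using B by (simp add: less_imp_le)
    define D where "D = ennreal Ga * (ennreal (B * W) + (\<integral>\<^sup>+y. ennreal (norm (g y)) \<partial>lborel))"
    have D: "D < \<infinity>"
      using ig unfolding D_def by (auto simp: integrable_iff_bounded ennreal_mult_less_top)
    have potE: "(\<integral>\<^sup>+y. \<integral>\<^sup>+u. ennreal (norm (E u x y *\<^sub>R g y)) \<partial>lborel \<partial>lborel) \<le> D" for x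
    proof -
      have "(\<integral>\<^sup>+y. \<integral>\<^sup>+u. ennreal (norm (E u x y *\<^sub>R g y)) \<partial>lborel \<partial>lborel) =
          (\<integral>\<^sup>+y. ennreal Ga * ennreal (norm (x - y) powr (- \<gamma>) * norm (g y)) \<partial>lborel)"
      proof (rule nn_integral_cong_AE, use AE_lborel_singleton[of x] in eventually_elim)
        fix y assume "y \<noteq> x"
        have "(\<integral>\<^sup>+u. ennreal (norm (E u x y *\<^sub>R g y)) \<partial>lborel) = (\<integral>\<^sup>+u. ennreal (E u x y) * ennreal (norm (g y)) \<partial>lborel)"
          using E0 by (intro nn_integral_cong) (simp add: ennreal_mult' abs_of_pos less_imp_le)
        also have "\<dots> = ennreal (Ga * k x y) * ennreal (norm (g y))"
          using \<open>y \<noteq> x\<close> by (subst nn_integral_multc) (auto simp: int_E)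
        finally show "(\<integral>\<^sup>+u. ennreal (norm (E u x y *\<^sub>R g y)) \<partial>lborel) = ennreal Ga * ennreal (norm (x - y) powr (- \<gamma>) * norm (g y))"
          using Ga k0 by (simp add: ennreal_mult[symmetric] k_def powr_minus_divide)
      qed
      also have "\<dots> = ennreal Ga * (\<integral>\<^sup>+y. ennreal (norm (x - y) powr (- \<gamma>) * norm (g y)) \<partial>lborel)"
        by (rule nn_integral_cmult) measurable
      also have "\<dots> \<le> D"
        unfolding D_def by (intro mult_left_mono W) auto
      finally show ?thesis .
    qed
    \<comment> \<open>The potential of \<open>g\<close> is a mixture of Gaussian convolutions.\<close>
    have step1: "Ga *\<^sub>R (\<integral>y. k x y *\<^sub>R g y \<partial>lborel) = (\<integral>u. h u x \<partial>lborel)" for x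
    proof -
      have "(\<integral>u. h u x \<partial>lborel) = (\<integral>y. \<integral>u. E u x y *\<^sub>R g y \<partial>lborel \<partial>lborel)"
        unfolding h_def using D potE[of x] by (intro lborel_integral_swap[symmetric]) (auto intro: order.strict_trans1)
      also have "\<dots> = (\<integral>y. Ga *\<^sub>R (k x y *\<^sub>R g y) \<partial>lborel)"
      proof (rule integral_cong_AE)
        show "AE y in lborel. (\<integral>u. E u x y *\<^sub>R g y \<partial>lborel) = Ga *\<^sub>R (k x y *\<^sub>R g y)"
        proof (use AE_lborel_singleton[of x] in eventually_elim)
          fix y assume "y \<noteq> x"
          then have "has_bochner_integral lborel (\<lambda>u. E u x y) (Ga * k x y)"
            using int_E[of x y] E0 Ga(1) k0[of x y]
            by (intro has_bochner_integral_nn_integral) (auto simp: less_imp_le)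
          then have "has_bochner_integral lborel (\<lambda>u. E u x y *\<^sub>R g y) ((Ga * k x y) *\<^sub>R g y)"
            by (intro has_bochner_integral_scaleR_left)
          then show "(\<integral>u. E u x y *\<^sub>R g y \<partial>lborel) = Ga *\<^sub>R (k x y *\<^sub>R g y)"
            by (simp add: has_bochner_integral_iff)
        qed
        show "(\<lambda>y. \<integral>u. E u x y *\<^sub>R g y \<partial>lborel) \<in> borel_measurable lborel"
          by (rule lborel.borel_measurable_lebesgue_integral) (simp add: E_def split_beta')
        show "(\<lambda>y. Ga *\<^sub>R (k x y *\<^sub>R g y)) \<in> borel_measurable lborel" unfolding k_def by measurable
      qed
      finally show ?thesis by (simp only: integral_scaleR_right)
    qed
    \<comment> \<open>The potential is bounded and the transform of \<open>\<phi>\<close> is integrable, so the mixture can be taken outside.\<close>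
    have step2: "(\<integral>x. (\<integral>u. h u x \<partial>lborel) * fourier \<phi> x \<partial>lborel) = (\<integral>u. \<integral>x. h u x * fourier \<phi> x \<partial>lborel \<partial>lborel)"
    proof -
      have hb: "(\<integral>\<^sup>+u. ennreal (norm (h u x)) \<partial>lborel) \<le> D" for x
      proof -
        have "(\<integral>\<^sup>+u. ennreal (norm (h u x)) \<partial>lborel) \<le> (\<integral>\<^sup>+u. \<integral>\<^sup>+y. ennreal (norm (E u x y *\<^sub>R g y)) \<partial>lborel \<partial>lborel)"
          unfolding h_def by (intro nn_integral_mono norm_integral_le_nn_integral)
        also have "\<dots> = (\<integral>\<^sup>+y. \<integral>\<^sup>+u. ennreal (norm (E u x y *\<^sub>R g y)) \<partial>lborel \<partial>lborel)"
          by (rule lborel_pair.Fubini'[symmetric]) measurable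
        also note potE
        finally show ?thesis .
      qed
      have "(\<integral>\<^sup>+x. \<integral>\<^sup>+u. ennreal (norm (h u x * fourier \<phi> x)) \<partial>lborel \<partial>lborel) =
         (\<integral>\<^sup>+x. (\<integral>\<^sup>+u. ennreal (norm (h u x)) \<partial>lborel) * ennreal (norm (fourier \<phi> x)) \<partial>lborel)"
        by (intro nn_integral_cong) (simp add: norm_mult ennreal_mult nn_integral_multc)
      also have "\<dots> \<le> (\<integral>\<^sup>+x. D * ennreal (norm (fourier \<phi> x)) \<partial>lborel)"
        by (intro nn_integral_mono mult_right_mono hb) auto
      also have "\<dots> = D * (\<integral>\<^sup>+x. ennreal (norm (fourier \<phi> x)) \<partial>lborel)"
        by (rule nn_integral_cmult) measurable
      also have "\<dots> < \<infinity>"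
        using D fourier_integrable[OF \<phi>] by (simp add: integrable_iff_bounded ennreal_mult_less_top)
      finally have "(\<integral>x. \<integral>u. h u x * fourier \<phi> x \<partial>lborel \<partial>lborel) = (\<integral>u. \<integral>x. h u x * fourier \<phi> x \<partial>lborel \<partial>lborel)"
        by (intro lborel_integral_swap) measurable
      then show ?thesis by simp
    qed
    \<comment> \<open>For fixed \<open>u\<close> everything is integrable: move the Fourier transform from \<open>\<phi>\<close> to \<open>h u\<close>, then apply the convolution theorem.\<close>
    have step3: "(\<integral>x. h u x * fourier \<phi> x \<partial>lborel) = (\<integral>z. complex_of_real (m u z) * (fourier g z * \<phi> z) \<partial>lborel)" for u
    proof -
      have Eg: "(\<integral>\<^sup>+y. \<integral>\<^sup>+x. ennreal (norm (E u x y *\<^sub>R g y)) \<partial>lborel \<partial>lborel) < \<infinity>"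
      proof -
        have eq: "(\<integral>\<^sup>+x. ennreal (E u x y) \<partial>lborel) = ennreal (m u 0)" for y
        proof -
          have "has_bochner_integral lborel (\<lambda>x. complex_of_real (E u x y)) (complex_of_real (m u 0))"
            using gauss[of u y 0] by simp
          from has_bochner_integral_Re[OF this] show ?thesis
            using E0 by (simp add: has_bochner_integral_iff nn_integral_eq_integral less_imp_le)
        qed
        have "(\<integral>\<^sup>+y. \<integral>\<^sup>+x. ennreal (norm (E u x y *\<^sub>R g y)) \<partial>lborel \<partial>lborel) = (\<integral>\<^sup>+y. ennreal (m u 0) * ennreal (norm (g y)) \<partial>lborel)"
          using E0 by (intro nn_integral_cong) (simp add: ennreal_mult' abs_of_pos less_imp_le nn_integral_multc eq)
        also have "\<dots> = ennreal (m u 0) * (\<integral>\<^sup>+y. ennreal (norm (g y)) \<partial>lborel)"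
          by (rule nn_integral_cmult) measurable
        also have "\<dots> < \<infinity>"
          using ig by (simp add: integrable_iff_bounded ennreal_mult_less_top)
        finally show ?thesis .
      qed
      have hint: "(\<integral>\<^sup>+x. ennreal (norm (h u x)) \<partial>lborel) < \<infinity>"
      proof -
        have "(\<integral>\<^sup>+x. ennreal (norm (h u x)) \<partial>lborel) \<le> (\<integral>\<^sup>+x. \<integral>\<^sup>+y. ennreal (norm (E u x y *\<^sub>R g y)) \<partial>lborel \<partial>lborel)"
          unfolding h_def by (intro nn_integral_mono norm_integral_le_nn_integral)
        also have "\<dots> = (\<integral>\<^sup>+y. \<integral>\<^sup>+x. ennreal (norm (E u x y *\<^sub>R g y)) \<partial>lborel \<partial>lborel)"
          by (rule lborel_pair.Fubini'[symmetric]) measurable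
        also note Eg
        finally show ?thesis .
      qed
      have fh: "fourier (h u) z = complex_of_real (m u z) * fourier g z" for z
      proof -
        have "fourier (h u) z = (\<integral>x. \<integral>y. (complex_of_real (E u x y) * exp (- \<i> * complex_of_real (x \<bullet> z))) * g y \<partial>lborel \<partial>lborel)"
          unfolding fourier_def h_def integral_mult_right_zero[symmetric]
          by (intro Bochner_Integration.integral_cong refl) (simp add: scaleR_conv_of_real mult_ac)
        also have "\<dots> = (\<integral>y. \<integral>x. (complex_of_real (E u x y) * exp (- \<i> * complex_of_real (x \<bullet> z))) * g y \<partial>lborel \<partial>lborel)"
        proof (rule lborel_integral_swap[symmetric])
          show "(\<integral>\<^sup>+y. \<integral>\<^sup>+x. ennreal (norm ((complex_of_real (E u x y) * exp (- \<i> * complex_of_real (x \<bullet> z))) * g y)) \<partial>lborel \<partial>lborel) < \<infinity>"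
            using Eg by (simp add: norm_mult)
        qed measurable
        also have "\<dots> = (\<integral>y. complex_of_real (m u z) * (exp (- \<i> * complex_of_real (y \<bullet> z)) * g y) \<partial>lborel)"
          by (simp only: integral_mult_left_zero has_bochner_integral_integral_eq[OF gauss]) (simp only: mult.assoc)
        also have "\<dots> = complex_of_real (m u z) * fourier g z"
          unfolding fourier_def by (rule integral_mult_right_zero)
        finally show ?thesis .
      qed
      have "(\<integral>x. h u x * fourier \<phi> x \<partial>lborel) = (\<integral>x. \<integral>z. h u x * (exp (- \<i> * complex_of_real (z \<bullet> x)) * \<phi> z) \<partial>lborel \<partial>lborel)"
        unfolding fourier_def by simp
      also have "\<dots> = (\<integral>z. \<integral>x. h u x * (exp (- \<i> * complex_of_real (z \<bullet> x)) * \<phi> z) \<partial>lborel \<partial>lborel)"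
      proof (rule lborel_integral_swap)
        have "(\<integral>\<^sup>+x. \<integral>\<^sup>+z. ennreal (norm (h u x * (exp (- \<i> * complex_of_real (z \<bullet> x)) * \<phi> z))) \<partial>lborel \<partial>lborel)
           = (\<integral>\<^sup>+x. ennreal (norm (h u x)) * (\<integral>\<^sup>+z. ennreal (norm (\<phi> z)) \<partial>lborel) \<partial>lborel)"
          by (intro nn_integral_cong) (simp add: norm_mult ennreal_mult nn_integral_cmult)
        also have "\<dots> = (\<integral>\<^sup>+x. ennreal (norm (h u x)) \<partial>lborel) * (\<integral>\<^sup>+z. ennreal (norm (\<phi> z)) \<partial>lborel)"
          by (rule nn_integral_multc) measurable
        also have "\<dots> < \<infinity>"
          using hint i\<phi> by (simp add: integrable_iff_bounded ennreal_mult_less_top)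
        finally show "(\<integral>\<^sup>+x. \<integral>\<^sup>+z. ennreal (norm (h u x * (exp (- \<i> * complex_of_real (z \<bullet> x)) * \<phi> z))) \<partial>lborel \<partial>lborel) < \<infinity>" .
      qed measurable
      also have "\<dots> = (\<integral>z. (\<integral>x. exp (- \<i> * complex_of_real (x \<bullet> z)) * h u x \<partial>lborel) * \<phi> z \<partial>lborel)"
        unfolding integral_mult_left_zero[symmetric]
        by (intro Bochner_Integration.integral_cong refl) (simp add: inner_commute mult_ac)
      also have "\<dots> = (\<integral>z. fourier (h u) z * \<phi> z \<partial>lborel)" by (simp add: fourier_def)
      finally show ?thesis unfolding fh by (simp add: mult.assoc)
    qed
    \<comment> \<open>Put the mixture back together on the Fourier side; absolute integrability is that of \<open>\<bar>\<xi>\<bar> powr (- \<alpha>)\<close> near 0.\<close>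
    have step4: "(\<integral>u. \<integral>z. complex_of_real (m u z) * (fourier g z * \<phi> z) \<partial>lborel \<partial>lborel) =
      complex_of_real (p * 4 powr (\<alpha>/2) * Gb) * (\<integral>z. complex_of_real (norm z powr (- \<alpha>)) * fourier g z * \<phi> z \<partial>lborel)"
    proof -
      define C where "C = p * 4 powr (\<alpha>/2) * Gb"
      have C: "C > 0" using p Gb by (simp add: C_def)
      obtain B1 where B1: "B1 > 0" "\<And>x. norm (\<phi> x) \<le> B1" using Cc_infty_bounded[OF \<phi>] by blast
      define B2 where "B2 = (\<integral>x. norm (g x) \<partial>lborel)"
      have B2: "B2 \<ge> 0" "norm (fourier g z) \<le> B2" for z
        unfolding B2_def using fourier_bound[of g z] by simp_all
      define q where "q z = norm (fourier g z * \<phi> z)" for z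
      have q: "0 \<le> q z" "q z \<le> B2 * B1" "q z \<le> B2 * norm (\<phi> z)" for z
        unfolding q_def using B1 B2 by (auto simp: norm_mult intro!: mult_mono mult_right_mono)
      have [measurable]: "q \<in> borel_measurable borel" unfolding q_def by measurable
      have "\<alpha> < DIM(real^'n)" using \<alpha> by simp
      obtain W where "\<And>B (q::real^'n \<Rightarrow> real) x. B \<ge> 0 \<Longrightarrow> q \<in> borel_measurable borel \<Longrightarrow> (\<And>y. 0 \<le> q y \<and> q y \<le> B) \<Longrightarrow>
         (\<integral>\<^sup>+y. ennreal (norm (x - y) powr (- \<alpha>) * q y) \<partial>lborel) \<le> ennreal (B * W) + (\<integral>\<^sup>+y. ennreal (q y) \<partial>lborel)"
        by (rule powr_potential_bound[OF \<alpha>(1) \<open>\<alpha> < DIM(real^'n)\<close>], erule that)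
      from this[of "B2 * B1" q 0]
      have W: "(\<integral>\<^sup>+y. ennreal (norm (0 - y) powr (- \<alpha>) * q y) \<partial>lborel) \<le> ennreal (B2 * B1 * W) + (\<integral>\<^sup>+y. ennreal (q y) \<partial>lborel)"
        using B1(1) B2(1) q(1,2) by simp
      have "(\<integral>\<^sup>+y. ennreal (q y) \<partial>lborel) \<le> (\<integral>\<^sup>+y. ennreal B2 * ennreal (norm (\<phi> y)) \<partial>lborel)"
        using q B2(1) by (intro nn_integral_mono) (simp add: ennreal_mult[symmetric] ennreal_leI)
      also have "\<dots> = ennreal B2 * (\<integral>\<^sup>+y. ennreal (norm (\<phi> y)) \<partial>lborel)"
        by (rule nn_integral_cmult) measurable
      also have "\<dots> < \<infinity>"
        using i\<phi> by (simp add: integrable_iff_bounded ennreal_mult_less_top)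
      finally have "(\<integral>\<^sup>+y. ennreal (norm (0 - y) powr (- \<alpha>) * q y) \<partial>lborel) < \<infinity>"
        using W by (auto intro: order.strict_trans1)
      then have pot: "(\<integral>\<^sup>+y. ennreal (norm y powr (- \<alpha>) * q y) \<partial>lborel) < \<infinity>" by simp
      have AE0: "AE z in (lborel :: (real^'n) measure). z \<noteq> 0" by (rule AE_lborel_singleton)
      have "(\<integral>z. \<integral>u. complex_of_real (m u z) * (fourier g z * \<phi> z) \<partial>lborel \<partial>lborel) = (\<integral>u. \<integral>z. complex_of_real (m u z) * (fourier g z * \<phi> z) \<partial>lborel \<partial>lborel)"
      proof (rule lborel_integral_swap)
        have "(\<integral>\<^sup>+z. \<integral>\<^sup>+u. ennreal (norm (complex_of_real (m u z) * (fourier g z * \<phi> z))) \<partial>lborel \<partial>lborel) =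
          (\<integral>\<^sup>+z. ennreal C * ennreal (norm z powr (- \<alpha>) * q z) \<partial>lborel)"
        proof (rule nn_integral_cong_AE, use AE0 in eventually_elim)
          fix z :: "real^'n" assume z: "z \<noteq> 0"
          have "(\<integral>\<^sup>+u. ennreal (norm (complex_of_real (m u z) * (fourier g z * \<phi> z))) \<partial>lborel) = (\<integral>\<^sup>+u. ennreal (m u z) * ennreal (q z) \<partial>lborel)"
            using m0 by (intro nn_integral_cong) (simp add: norm_mult q_def ennreal_mult' abs_of_pos less_imp_le)
          also have "\<dots> = ennreal (C * norm z powr (- \<alpha>)) * ennreal (q z)"
            using z by (subst nn_integral_multc) (auto simp: int_m C_def)
          finally show "(\<integral>\<^sup>+u. ennreal (norm (complex_of_real (m u z) * (fourier g z * \<phi> z))) \<partial>lborel) = ennreal C * ennreal (norm z powr (- \<alpha>) * q z)"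
            using C q by (simp add: ennreal_mult[symmetric] mult.assoc)
        qed
        also have "\<dots> = ennreal C * (\<integral>\<^sup>+z. ennreal (norm z powr (- \<alpha>) * q z) \<partial>lborel)"
          by (rule nn_integral_cmult) measurable
        also have "\<dots> < \<infinity>" using pot by (simp add: ennreal_mult_less_top)
        finally show "(\<integral>\<^sup>+z. \<integral>\<^sup>+u. ennreal (norm (complex_of_real (m u z) * (fourier g z * \<phi> z))) \<partial>lborel \<partial>lborel) < \<infinity>" .
      qed (simp add: m_def split_beta')
      also have "(\<integral>z. \<integral>u. complex_of_real (m u z) * (fourier g z * \<phi> z) \<partial>lborel \<partial>lborel) = (\<integral>z. complex_of_real C * (complex_of_real (norm z powr (- \<alpha>)) * fourier g z * \<phi> z) \<partial>lborel)"
      proof (rule integral_cong_AE)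
        show "AE z in lborel. (\<integral>u. complex_of_real (m u z) * (fourier g z * \<phi> z) \<partial>lborel) = complex_of_real C * (complex_of_real (norm z powr (- \<alpha>)) * fourier g z * \<phi> z)"
        proof (use AE0 in eventually_elim)
          fix z :: "real^'n" assume z: "z \<noteq> 0"
          have "has_bochner_integral lborel (\<lambda>u. m u z) (C * norm z powr (- \<alpha>))"
            using int_m[OF z] m0 C unfolding C_def
            by (intro has_bochner_integral_nn_integral) (auto simp: less_imp_le m_def)
          then have "has_bochner_integral lborel (\<lambda>u. complex_of_real (m u z) * (fourier g z * \<phi> z)) (complex_of_real (C * norm z powr (- \<alpha>)) * (fourier g z * \<phi> z))"
            by (intro has_bochner_integral_mult_left has_bochner_integral_of_real)
          then show "(\<integral>u. complex_of_real (m u z) * (fourier g z * \<phi> z) \<partial>lborel) = complex_of_real C * (complex_of_real (norm z powr (- \<alpha>)) * fourier g z * \<phi> z)"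
            by (simp add: has_bochner_integral_iff mult.assoc)
        qed
        show "(\<lambda>z. \<integral>u. complex_of_real (m u z) * (fourier g z * \<phi> z) \<partial>lborel) \<in> borel_measurable lborel"
          by (rule lborel.borel_measurable_lebesgue_integral) (simp add: m_def split_beta')
      qed measurable
      finally show ?thesis by (simp add: C_def)
    qed
    have "riesz_with_const c \<alpha> g x = complex_of_real (c / Ga) * (\<integral>u. h u x \<partial>lborel)" for x
      unfolding step1[symmetric] riesz_with_const_def k_def \<gamma>_def
      using Ga(1) by (simp add: scaleR_conv_of_real)
    then have "(\<integral>x. riesz_with_const c \<alpha> g x * fourier \<phi> x \<partial>lborel) = complex_of_real (c / Ga) * (\<integral>x. (\<integral>u. h u x \<partial>lborel) * fourier \<phi> x \<partial>lborel)"
      by (simp add: mult.assoc)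
    also have "\<dots> = complex_of_real (c / Ga * (p * 4 powr (\<alpha>/2) * Gb)) * (\<integral>z. complex_of_real (norm z powr (- \<alpha>)) * fourier g z * \<phi> z \<partial>lborel)"
      unfolding step2 step3 step4 by simp
    also have "c / Ga * (p * 4 powr (\<alpha>/2) * Gb) = 1"
      using Ga Gb p by (simp add: c_def)
    finally show "(\<integral>x. riesz_with_const c \<alpha> g x * fourier \<phi> x \<partial>lborel) = (\<integral>z. complex_of_real (norm z powr (- \<alpha>)) * fourier g z * \<phi> z \<partial>lborel)"
      by simp
  qed
  with c show ?thesis by blast
qed

lemma riesz_const_pos:
  assumes "0 < \<alpha>" "\<alpha> < real CARD('n)"
  shows "riesz_const TYPE('n::finite) \<alpha> > 0"
  using someI_ex[of "\<lambda>c. c > 0 \<and> riesz_normalizes TYPE('n) \<alpha> c"] riesz_normalizes_exists[OF assms]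
  unfolding riesz_const_def by blast

section \<open>Powers of extended nonnegative reals\<close>

lemma ennpow_top [simp]: "ennpow top p = top"
  by (simp add: ennpow_def)

lemma ennpow_ennreal: "r \<ge> 0 \<Longrightarrow> ennpow (ennreal r) p = ennreal (r powr p)"
  by (simp add: ennpow_def)

lemma ennpow_0 [simp]: "ennpow 0 p = 0"
  using ennpow_ennreal[of 0 p] by simp

lemma ennpow_mono:
  assumes "0 \<le> p" "a \<le> b" shows "ennpow a p \<le> ennpow b p"
proof (cases b)
  case (real s)
  then obtain r where r: "a = ennreal r" "r \<ge> 0" using assms(2) by (cases a) (auto simp: top_unique)
  then have "r \<le> s" using real assms(2) by simp
  then show ?thesis using real r assms(1) by (simp add: ennpow_ennreal powr_mono2)
qed simp

lemma ennpow_ennpow: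
  assumes "p > 0" shows "ennpow (ennpow a p) (1 / p) = a" "ennpow (ennpow a (1 / p)) p = a"
  using assms by (cases a; simp add: ennpow_ennreal powr_powr)+

section \<open>The maximal function controls the Riesz kernel\<close>

lemma emeasure_cube:
  fixes a :: "real^'n::finite"
  assumes "l \<ge> 0"
  shows "emeasure lborel (cbox a (a + (\<chi> i. l))) = ennreal (l ^ CARD('n))"
proof -
  have "(\<chi> i. l) \<bullet> b = l" if b: "b \<in> Basis" for b :: "real^'n"
  proof -
    obtain i where "b = axis i 1" using b by (auto simp: Basis_vec_def)
    then show ?thesis by (simp add: inner_axis)
  qed
  then show ?thesis
    using assms by (subst emeasure_lborel_cbox) (auto simp: inner_add_left)
qed

lemma emeasure_cube_le_maximal:
  fixes \<mu> :: "(real^'n::finite) measure"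
  assumes l: "l > 0" and y: "y \<in> cbox a (a + (\<chi> i. l))"
  shows "emeasure \<mu> (cbox a (a + (\<chi> i. l))) \<le> maximal \<mu> y * ennreal (l ^ CARD('n))"
proof -
  let ?Q = "cbox a (a + (\<chi> i. l))"
  have v: "emeasure lborel ?Q = ennreal (l ^ CARD('n))" using l by (intro emeasure_cube) simp
  have "emeasure \<mu> ?Q / emeasure lborel ?Q \<le> maximal \<mu> y"
    unfolding maximal_def using l y by (intro SUP_upper) (auto simp: cubes_def)
  then have "emeasure \<mu> ?Q / emeasure lborel ?Q * emeasure lborel ?Q \<le> maximal \<mu> y * emeasure lborel ?Q"
    by (rule mult_right_mono) simp
  moreover have "emeasure \<mu> ?Q / emeasure lborel ?Q * emeasure lborel ?Q = emeasure \<mu> ?Q"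
    unfolding v using l by (simp add: ennreal_divide_times ennreal_times_divide[symmetric])
  ultimately show ?thesis by (simp add: v)
qed

lemma emeasure_cball_le_maximal:
  fixes \<mu> :: "(real^'n::finite) measure"
  assumes s: "sets \<mu> = sets borel" and \<rho>: "\<rho> > 0"
  shows "emeasure \<mu> (cball y \<rho>) \<le> maximal \<mu> y * ennreal ((2 * \<rho>) ^ CARD('n))"
proof -
  let ?a = "y - (\<chi> i. \<rho>)"
  have "cball y \<rho> \<subseteq> cbox ?a (?a + (\<chi> i. 2 * \<rho>))"
  proof
    fix x assume "x \<in> cball y \<rho>"
    then have "norm (x - y) \<le> \<rho>" by (simp add: dist_norm norm_minus_commute)
    then have "\<bar>x $ i - y $ i\<bar> \<le> \<rho>" for i using component_le_norm_cart[of "x - y" i] by simp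
    then show "x \<in> cbox ?a (?a + (\<chi> i. 2 * \<rho>))"
      by (simp add: mem_box_cart abs_le_iff) (smt (verit))
  qed
  then have "emeasure \<mu> (cball y \<rho>) \<le> emeasure \<mu> (cbox ?a (?a + (\<chi> i. 2 * \<rho>)))"
    by (intro emeasure_mono) (simp_all add: s)
  also have "\<dots> \<le> maximal \<mu> y * ennreal ((2 * \<rho>) ^ CARD('n))"
    using \<rho> by (intro emeasure_cube_le_maximal) (auto simp: mem_box_cart)
  finally show ?thesis .
qed

lemma dyadic_scale:
  fixes d r :: real
  assumes "0 < d" "d \<le> r"
  shows "\<exists>k. r / 2 ^ Suc k < d \<and> d \<le> r / 2 ^ k"
proof -
  obtain j where "r / d < 2 ^ j" using real_arch_pow[of 2 "r/d"] by auto
  then have ex: "r / 2 ^ j < d" using assms by (simp add: field_simps)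
  define k where "k = (LEAST j. r / 2 ^ j < d)"
  have k: "r / 2 ^ k < d" unfolding k_def by (rule LeastI[of "\<lambda>j. r / 2 ^ j < d", OF ex])
  then obtain k' where k': "k = Suc k'" using assms by (cases k) auto
  then have "\<not> r / 2 ^ k' < d" using not_less_Least[of k' "\<lambda>j. r / 2 ^ j < d"] by (simp add: k_def[symmetric])
  then show ?thesis using k k' by (intro exI[of _ k']) auto
qed

text \<open>
  If \<open>d\<close> lies in the dyadic shell between \<open>r / 2 ^ Suc k\<close> and \<open>r / 2 ^ k\<close>, the term with this index
  dominates; if \<open>d > r\<close>, the last summand does. At \<open>d = 0\<close> the left-hand side is \<open>1 / 0 = 0\<close>, so
  that a point mass of the measure at the singularity does no harm below.
\<close>

lemma dyadic_kernel_bound: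
  fixes d r \<gamma> :: real
  assumes "0 \<le> d" "0 < r" "0 < \<gamma>"
  shows "ennreal (1 / d powr \<gamma>) \<le> (\<Sum>k. ennreal ((r / 2 ^ Suc k) powr (- \<gamma>)) * indicator {..r / 2 ^ k} d) + ennreal (r powr (- \<gamma>))"
proof (cases "d = 0 \<or> d > r")
  case True
  then have "1 / d powr \<gamma> \<le> r powr (- \<gamma>)"
    using assms by (auto simp: powr_minus_divide frac_le powr_mono2)
  then show ?thesis by (simp add: add_increasing ennreal_leI)
next
  case False
  then obtain k where k: "r / 2 ^ Suc k < d" "d \<le> r / 2 ^ k"
    using dyadic_scale[of d r] assms by auto
  have "1 / d powr \<gamma> \<le> (r / 2 ^ Suc k) powr (- \<gamma>)"
    using k(1) assms powr_mono2'[of "-\<gamma>" "r / 2 ^ Suc k" d] by (simp add: powr_minus_divide)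
  then have "ennreal (1 / d powr \<gamma>) \<le> ennreal ((r / 2 ^ Suc k) powr (- \<gamma>)) * indicator {..r / 2 ^ k} d"
    using k(2) by (simp add: ennreal_leI)
  also have "\<dots> \<le> (\<Sum>k. ennreal ((r / 2 ^ Suc k) powr (- \<gamma>)) * indicator {..r / 2 ^ k} d)"
  proof -
    have "f k \<le> suminf f" for f :: "nat \<Rightarrow> ennreal"
      using sum_le_suminf[of f "{k}"] by simp
    then show ?thesis .
  qed
  finally show ?thesis by (simp add: add_increasing2)
qed

text \<open>
  Integrate \<open>dyadic_kernel_bound\<close>. The ball of radius \<open>r / 2 ^ k\<close> has measure at most
  \<open>A (2 r / 2 ^ k) ^ n\<close>, and since \<open>\<alpha> > 0\<close> the resulting series is geometric with ratio
  \<open>2 powr (- \<alpha>)\<close>.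
\<close>

lemma kernel_integral_split:
  fixes \<mu> :: "(real^'n::finite) measure"
  assumes s: "sets \<mu> = sets borel" and F: "F \<in> sets borel" and r: "r > 0" and A: "maximal \<mu> y = ennreal A" "A \<ge> 0"
    and \<alpha>: "0 < \<alpha>" "\<alpha> < real CARD('n)"
  shows "(\<integral>\<^sup>+x. ennreal (1 / norm (x - y) powr (real CARD('n) - \<alpha>)) * indicator F x \<partial>\<mu>)
     \<le> ennreal (A * r powr \<alpha> * (2 powr (2 * real CARD('n) - \<alpha>) / (1 - 2 powr (- \<alpha>)))) + ennreal (r powr (\<alpha> - real CARD('n))) * emeasure \<mu> F"
proof -
  let ?n = "real CARD('n)"
  define \<gamma> where "\<gamma> = ?n - \<alpha>"
  have \<gamma>: "\<gamma> > 0" using \<alpha> by (simp add: \<gamma>_def)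
  let ?c = "\<lambda>k. (r / 2 ^ Suc k) powr (- \<gamma>)"
  have [measurable_cong]: "sets \<mu> = sets borel" by (rule s)
  have [measurable]: "F \<in> sets borel" by (rule F)
  have "(\<integral>\<^sup>+x. ennreal (1 / norm (x - y) powr \<gamma>) * indicator F x \<partial>\<mu>)
    \<le> (\<integral>\<^sup>+x. (\<Sum>k. ennreal (?c k) * indicator (cball y (r / 2 ^ k)) x) + ennreal (r powr (- \<gamma>)) * indicator F x \<partial>\<mu>)"
  proof (rule nn_integral_mono)
    fix x
    have "indicator {..r / 2 ^ k} (norm (x - y)) = (indicator (cball y (r / 2 ^ k)) x :: ennreal)" for k
      by (simp add: indicator_def dist_norm norm_minus_commute)
    then have "ennreal (1 / norm (x - y) powr \<gamma>) \<le> (\<Sum>k. ennreal (?c k) * indicator (cball y (r / 2 ^ k)) x) + ennreal (r powr (- \<gamma>))"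
      using dyadic_kernel_bound[of "norm (x - y)" r \<gamma>] r \<gamma> by simp
    then show "ennreal (1 / norm (x - y) powr \<gamma>) * indicator F x \<le> (\<Sum>k. ennreal (?c k) * indicator (cball y (r / 2 ^ k)) x) + ennreal (r powr (- \<gamma>)) * indicator F x"
      by (cases "x \<in> F") auto
  qed
  also have "\<dots> = (\<Sum>k. ennreal (?c k) * emeasure \<mu> (cball y (r / 2 ^ k))) + ennreal (r powr (- \<gamma>)) * emeasure \<mu> F"
  proof -
    have m: "(\<lambda>x. ennreal (?c k) * indicator (cball y (r / 2 ^ k)) x) \<in> borel_measurable \<mu>" for k
      by (intro borel_measurable_times_ennreal borel_measurable_const borel_measurable_indicator) (simp add: s)
    have mF: "(\<lambda>x. ennreal (r powr (- \<gamma>)) * indicator F x) \<in> borel_measurable \<mu>"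
      by (intro borel_measurable_times_ennreal borel_measurable_const borel_measurable_indicator) (simp add: s F)
    have "(\<integral>\<^sup>+x. (\<Sum>k. ennreal (?c k) * indicator (cball y (r / 2 ^ k)) x) + ennreal (r powr (- \<gamma>)) * indicator F x \<partial>\<mu>)
      = (\<integral>\<^sup>+x. (\<Sum>k. ennreal (?c k) * indicator (cball y (r / 2 ^ k)) x) \<partial>\<mu>) + (\<integral>\<^sup>+x. ennreal (r powr (- \<gamma>)) * indicator F x \<partial>\<mu>)"
      by (rule nn_integral_add[OF borel_measurable_suminf_order[OF m] mF])
    also have "(\<integral>\<^sup>+x. (\<Sum>k. ennreal (?c k) * indicator (cball y (r / 2 ^ k)) x) \<partial>\<mu>) = (\<Sum>k. \<integral>\<^sup>+x. ennreal (?c k) * indicator (cball y (r / 2 ^ k)) x \<partial>\<mu>)"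
      by (rule nn_integral_suminf[OF m])
    also have "\<dots> = (\<Sum>k. ennreal (?c k) * emeasure \<mu> (cball y (r / 2 ^ k)))"
      by (subst nn_integral_cmult_indicator) (simp_all only: s borel_closed closed_cball)
    also have "(\<integral>\<^sup>+x. ennreal (r powr (- \<gamma>)) * indicator F x \<partial>\<mu>) = ennreal (r powr (- \<gamma>)) * emeasure \<mu> F"
      by (rule nn_integral_cmult_indicator) (simp only: s F)
    finally show ?thesis .
  qed
  also have "(\<Sum>k. ennreal (?c k) * emeasure \<mu> (cball y (r / 2 ^ k))) \<le> (\<Sum>k. ennreal (A * r powr \<alpha> * 2 powr (2 * ?n - \<alpha>) * (2 powr (- \<alpha>)) ^ k))"
  proof (intro suminf_le)
    fix k
    have "emeasure \<mu> (cball y (r / 2 ^ k)) \<le> ennreal A * ennreal ((2 * (r / 2 ^ k)) ^ CARD('n))"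
      unfolding A(1)[symmetric] using r by (intro emeasure_cball_le_maximal s) simp
    then have "ennreal (?c k) * emeasure \<mu> (cball y (r / 2 ^ k)) \<le> ennreal (?c k) * (ennreal A * ennreal ((2 * (r / 2 ^ k)) ^ CARD('n)))"
      by (rule mult_left_mono) simp
    also have "\<dots> = ennreal (?c k * (A * (2 * (r / 2 ^ k)) ^ CARD('n)))"
      using r A by (simp add: ennreal_mult[symmetric])
    also have "?c k * (A * (2 * (r / 2 ^ k)) ^ CARD('n)) = A * r powr \<alpha> * 2 powr (2 * ?n - \<alpha>) * (2 powr (- \<alpha>)) ^ k"
    proof -
      have "?c k = r powr (- \<gamma>) * 2 powr (real (Suc k) * \<gamma>)"
        using r by (simp add: powr_divide powr_powr powr_minus_divide divide_simps del: power_Suc of_nat_Suc flip: powr_realpow)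
      moreover have "(2 * (r / 2 ^ k)) ^ CARD('n) = r powr ?n * 2 powr (?n - real k * ?n)"
        using r by (simp add: power_mult_distrib power_divide powr_diff powr_realpow powr_powr flip: powr_realpow)
      moreover have "(2 powr (- \<alpha>)) ^ k = 2 powr (- \<alpha> * real k)"
        by (simp add: powr_power mult.commute)
      moreover have "r powr (- \<gamma>) * r powr ?n = r powr \<alpha>"
        using r by (simp add: powr_add[symmetric] \<gamma>_def)
      moreover have "2 powr (real (Suc k) * \<gamma>) * 2 powr (?n - real k * ?n) = 2 powr (2 * ?n - \<alpha>) * (2::real) powr (- \<alpha> * real k)"
        unfolding powr_add[symmetric] by (rule arg_cong[where f="(powr) 2"]) (simp add: \<gamma>_def algebra_simps)
      moreover have "c * (A * w) = A * ra * t * q"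
        if "c = r1 * p1" "w = r2 * p2" "q = q'" "r1 * r2 = ra" "p1 * p2 = t * q'" for c w q q' r1 r2 p1 p2 ra t :: real
      proof -
        have "c * (A * w) = A * (r1 * r2) * (p1 * p2)" using that(1,2) by simp
        then show ?thesis using that(3-5) by simp
      qed
      ultimately show ?thesis by blast
    qed
    finally show "ennreal (?c k) * emeasure \<mu> (cball y (r / 2 ^ k)) \<le> ennreal (A * r powr \<alpha> * 2 powr (2 * ?n - \<alpha>) * (2 powr (- \<alpha>)) ^ k)" .
  qed auto
  also have "\<dots> = ennreal (A * r powr \<alpha> * (2 powr (2 * ?n - \<alpha>) / (1 - 2 powr (- \<alpha>))))"
  proof -
    have "2 powr (- \<alpha>) < (1::real)" using \<alpha> by (simp add: powr_less_one)
    then have "(\<lambda>k. (2 powr (- \<alpha>)) ^ k) sums (1 / (1 - 2 powr (- \<alpha>)))"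
      by (intro geometric_sums) simp
    from sums_mult[OF this, of "A * r powr \<alpha> * 2 powr (2 * ?n - \<alpha>)"] show ?thesis
      using A r by (intro suminf_ennreal_eq) auto
  qed
  finally show ?thesis by (simp add: \<gamma>_def add_right_mono)
qed

text \<open>The sum of the geometric series in \<open>kernel_integral_split\<close>, plus 1 for the part beyond the radius.\<close>

definition riesz_weak_const :: "'n::finite itself \<Rightarrow> real \<Rightarrow> real"
  where "riesz_weak_const _ \<alpha> = 2 powr (2 * real CARD('n) - \<alpha>) / (1 - 2 powr (- \<alpha>)) + 1"

lemma riesz_weak_const_pos:
  assumes "0 < \<alpha>" shows "riesz_weak_const TYPE('n::finite) \<alpha> > 0"
proof -
  have "2 powr (- \<alpha>) < (1::real)" using assms by (simp add: powr_less_one)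
  then show ?thesis unfolding riesz_weak_const_def by (intro add_nonneg_pos divide_nonneg_pos) auto
qed

text \<open>
  Let \<open>v\<close> be the measure of \<open>F\<close> and \<open>A\<close> the value of the maximal function at \<open>y\<close>. The two
  contributions in \<open>kernel_integral_split\<close> balance when \<open>r ^ n = v / A\<close>, and then both are multiples
  of \<open>v powr (\<alpha>/n) * A powr (1 - \<alpha>/n)\<close>. If \<open>A = 0\<close>, all balls about \<open>y\<close> are null, hence so
  is \<open>F\<close>; if \<open>A\<close> is infinite and \<open>F\<close> is not null, the right-hand side is infinite.
\<close>

lemma kernel_integral_le_maximal:
  fixes \<mu> :: "(real^'n::finite) measure"
  assumes s: "sets \<mu> = sets borel" and F: "F \<in> sets borel" and fin: "emeasure \<mu> F < \<infinity>"
    and \<alpha>: "0 < \<alpha>" "\<alpha> < real CARD('n)"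
  shows "(\<integral>\<^sup>+x. ennreal (1 / norm (x - y) powr (real CARD('n) - \<alpha>)) * indicator F x \<partial>\<mu>)
     \<le> ennreal (riesz_weak_const TYPE('n) \<alpha>) * (ennpow (emeasure \<mu> F) (\<alpha> / real CARD('n)) * ennpow (maximal \<mu> y) (1 - \<alpha> / real CARD('n)))"
proof -
  let ?n = "real CARD('n)" and ?D = "riesz_weak_const TYPE('n) \<alpha>"
  let ?I = "(\<integral>\<^sup>+x. ennreal (1 / norm (x - y) powr (?n - \<alpha>)) * indicator F x \<partial>\<mu>)"
  have D: "?D > 0" using \<alpha> by (intro riesz_weak_const_pos)
  have [measurable_cong]: "sets \<mu> = sets borel" by (rule s)
  have n: "?n > 0" by simp
  obtain v where v: "emeasure \<mu> F = ennreal v" "v \<ge> 0" using fin by (cases "emeasure \<mu> F") auto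
  show ?thesis
  proof (cases "v = 0")
    case True
    then have "F \<in> null_sets \<mu>" using v F s by (auto intro!: null_setsI)
    then have "?I = 0" by (rule nn_integral_null_set)
    then show ?thesis by simp
  next
    case False
    then have v0: "v > 0" using v by simp
    show ?thesis
    proof (cases "maximal \<mu> y")
      case top
      have "ennpow (emeasure \<mu> F) (\<alpha> / ?n) > 0" using v v0 by (simp add: ennpow_ennreal)
      then show ?thesis using top D by (simp add: ennreal_mult_top ennreal_mult_eq_top_iff)
    next
      case (real A)
      have "A \<noteq> 0"
      proof
        assume "A = 0"
        then have z: "emeasure \<mu> (cball y (real (Suc k))) = 0" for k
          using emeasure_cball_le_maximal[OF s, of "real (Suc k)" y] real by simp
        have "(\<Union>k. cball y (real (Suc k))) = UNIV"
        proof -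
          have "\<exists>k. dist y x \<le> real (Suc k)" for x
            using real_arch_simple[of "dist y x"] by (meson le_SucI of_nat_mono order_refl order_trans)
          then show ?thesis by auto
        qed
        moreover have "(\<Union>k. cball y (real (Suc k))) \<in> null_sets \<mu>"
          using z by (intro null_sets_UN null_setsI) (auto simp: s)
        ultimately have "emeasure \<mu> UNIV = 0" by auto
        moreover have "emeasure \<mu> F \<le> emeasure \<mu> UNIV" by (intro emeasure_mono) (auto simp: s)
        ultimately show False using v v0 by simp
      qed
      then have A0: "A > 0" using real by simp
      define r where "r = (v / A) powr (1 / ?n)"
      have r: "r > 0" using v0 A0 by (simp add: r_def)
      have "?I \<le> ennreal (A * r powr \<alpha> * (2 powr (2 * ?n - \<alpha>) / (1 - 2 powr (- \<alpha>)))) + ennreal (r powr (\<alpha> - ?n)) * emeasure \<mu> F"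
        using real by (intro kernel_integral_split s F r \<alpha>) auto
      also have "A * r powr \<alpha> = v powr (\<alpha> / ?n) * A powr (1 - \<alpha> / ?n)"
        using v0 A0 by (simp add: r_def powr_powr powr_divide powr_diff)
      also have "ennreal (r powr (\<alpha> - ?n)) * emeasure \<mu> F = ennreal (v powr (\<alpha> / ?n) * A powr (1 - \<alpha> / ?n))"
      proof -
        have "r powr (\<alpha> - ?n) = (v / A) powr (\<alpha> / ?n - 1)"
          using n by (simp add: r_def powr_powr diff_divide_distrib)
        also have "\<dots> * v = v powr (\<alpha> / ?n) * A powr (1 - \<alpha> / ?n)"
        proof -
          have "(v / A) powr (\<delta> - 1) * v = v powr \<delta> * A powr (1 - \<delta>)" for \<delta>
            using v0 A0 by (simp add: powr_divide powr_diff)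
          then show ?thesis .
        qed
        finally show ?thesis using v by (simp add: ennreal_mult[symmetric])
      qed
      finally have "?I \<le> ennreal (v powr (\<alpha> / ?n) * A powr (1 - \<alpha> / ?n) * (?D - 1)) + ennreal (v powr (\<alpha> / ?n) * A powr (1 - \<alpha> / ?n))"
        by (simp add: riesz_weak_const_def)
      also have "\<dots> = ennreal (?D * (v powr (\<alpha> / ?n) * A powr (1 - \<alpha> / ?n)))"
      proof -
        have "2 powr (- \<alpha>) < (1::real)" using \<alpha> by (simp add: powr_less_one)
        then have "?D - 1 \<ge> 0" unfolding riesz_weak_const_def by simp
        moreover have "ennreal (X * (D - 1)) + ennreal X = ennreal (D * X)" if "D - 1 \<ge> 0" "X \<ge> 0" for D X :: real
        proof -
          have "X * (D - 1) \<ge> 0" using that by simp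
          then have "ennreal (X * (D - 1)) + ennreal X = ennreal (X * (D - 1) + X)"
            using that by (simp only: ennreal_plus)
          then show ?thesis by (simp add: algebra_simps)
        qed
        ultimately show ?thesis by simp
      qed
      also have "\<dots> = ennreal ?D * (ennpow (emeasure \<mu> F) (\<alpha> / ?n) * ennpow (maximal \<mu> y) (1 - \<alpha> / ?n))"
        using v real D by (simp add: ennpow_ennreal ennreal_mult)
      finally show ?thesis .
    qed
  qed
qed

section \<open>The weak-type estimate\<close>

lemma locally_finite_compact:
  assumes \<mu>: "locally_finite_borel \<mu>" and K: "compact K"
  shows "emeasure \<mu> K < \<infinity>"
proof -
  have s: "sets \<mu> = sets borel" using \<mu> by (simp add: locally_finite_borel_def)
  obtain U where U: "\<And>x. open (U x) \<and> x \<in> U x \<and> emeasure \<mu> (U x) < \<infinity>"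
    using \<mu> unfolding locally_finite_borel_def by metis
  obtain J where J: "J \<subseteq> K" "finite J" "K \<subseteq> (\<Union>x\<in>J. U x)"
    using compactE_image[OF K, of K U] U by blast
  have "emeasure \<mu> K \<le> emeasure \<mu> (\<Union>x\<in>J. U x)"
    using J(3) U by (intro emeasure_mono) (auto simp: s intro!: borel_open)
  also have "\<dots> \<le> (\<Sum>x\<in>J. emeasure \<mu> (U x))"
    using J(2) U by (intro emeasure_subadditive_finite) (auto simp: s)
  also have "\<dots> < \<infinity>" using U J(2) by (simp add: less_top)
  finally show ?thesis .
qed

lemma locally_finite_sigma_finite:
  assumes \<mu>: "locally_finite_borel \<mu>"
  shows "sigma_finite_measure \<mu>"
proof
  have s: "sets \<mu> = sets borel" using \<mu> by (simp add: locally_finite_borel_def)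
  have "(\<Union>k. cball 0 (real k)) = (UNIV :: (real^'a) set)"
    using real_arch_simple by (auto simp: dist_norm)
  then show "\<exists>A. countable A \<and> A \<subseteq> sets \<mu> \<and> \<Union> A = space \<mu> \<and> (\<forall>a\<in>A. emeasure \<mu> a \<noteq> \<infinity>)"
    using locally_finite_compact[OF \<mu> compact_cball] sets_eq_imp_space_eq[OF s]
    by (intro exI[of _ "range (\<lambda>k. cball 0 (real k))"]) (auto simp: s less_top)
qed

text \<open>
  The constant is pulled out of the integral of \<open>f\<close>, the measurable side; in the application,
  \<open>h\<close> contains the maximal function.
\<close>

lemma nn_integral_le_cmult:
  assumes f: "f \<in> borel_measurable M" and c: "c > 0" and le: "\<And>x. f x \<le> ennreal c * h x"
  shows "(\<integral>\<^sup>+x. f x \<partial>M) \<le> ennreal c * (\<integral>\<^sup>+x. h x \<partial>M)"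
proof -
  have i: "ennreal c * (ennreal (1 / c) * z) = z" "ennreal (1 / c) * (ennreal c * z) = z" for z
    using c by (simp_all add: mult.assoc[symmetric] ennreal_mult[symmetric])
  have "ennreal (1 / c) * (\<integral>\<^sup>+x. f x \<partial>M) = (\<integral>\<^sup>+x. ennreal (1 / c) * f x \<partial>M)"
    by (rule nn_integral_cmult[symmetric, OF f])
  also have "\<dots> \<le> (\<integral>\<^sup>+x. h x \<partial>M)"
    using mult_left_mono[OF le, of "ennreal (1 / c)"] by (intro nn_integral_mono) (simp add: i)
  finally have "ennreal c * (ennreal (1 / c) * (\<integral>\<^sup>+x. f x \<partial>M)) \<le> ennreal c * (\<integral>\<^sup>+x. h x \<partial>M)"
    by (rule mult_left_mono) simp
  then show ?thesis by (simp add: i)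
qed

text \<open>
  With \<open>p = 1 - \<alpha>/n\<close>, integrate the pointwise bound over a set \<open>F\<close> of finite measure inside the
  level set \<open>E\<close>, exchange the integrals, and bound the inner one by
  \<open>kernel_integral_le_maximal\<close>. The factor \<open>\<mu>(F) powr (\<alpha>/n)\<close> is then divided out, which needs
  \<open>\<mu>(F)\<close> finite; the sets \<open>E \<inter> cball 0 k\<close> exhaust \<open>E\<close>.
\<close>

lemma riesz_weak_type:
  fixes \<mu> :: "(real^'n::finite) measure" and u :: "real^'n \<Rightarrow> 'k::real_normed_vector" and g :: "real^'n \<Rightarrow> real"
  assumes \<alpha>: "0 < \<alpha>" "\<alpha> < real CARD('n)" and \<mu>: "locally_finite_borel \<mu>"
    and u: "u \<in> borel_measurable borel" and g: "g \<in> borel_measurable borel" "\<And>y. 0 \<le> g y" and K: "K > 0"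
    and le: "\<And>x. ennreal (norm (u x)) \<le> ennreal K * (\<integral>\<^sup>+y. ennreal (1 / norm (x - y) powr (real CARD('n) - \<alpha>)) * ennreal (g y) \<partial>lborel)"
  shows "weak_norm (real CARD('n) / (real CARD('n) - \<alpha>)) \<mu> u
     \<le> ennreal (K * riesz_weak_const TYPE('n) \<alpha>) * (\<integral>\<^sup>+y. ennreal (g y) * ennpow (maximal \<mu> y) (1 - \<alpha> / real CARD('n)) \<partial>lborel)"
  unfolding weak_norm_def
proof (rule SUP_least)
  fix t :: real assume "t \<in> {0<..}"
  then have t: "t > 0" by simp
  let ?n = "real CARD('n)" and ?D = "riesz_weak_const TYPE('n) \<alpha>"
  define p where "p = 1 - \<alpha> / ?n"
  have p: "p > 0" "1 / (?n / (?n - \<alpha>)) = p" using \<alpha> by (simp_all add: p_def diff_divide_distrib)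
  define R where "R = (\<integral>\<^sup>+y. ennreal (g y) * ennpow (maximal \<mu> y) p \<partial>lborel)"
  let ?k = "\<lambda>x y. ennreal (1 / norm (x - y :: real^'n) powr (?n - \<alpha>))"
  have D: "?D > 0" using \<alpha> by (intro riesz_weak_const_pos)
  have s: "sets \<mu> = sets borel" using \<mu> by (simp add: locally_finite_borel_def)
  note [measurable_cong] = s
  have [simp]: "space \<mu> = UNIV" using sets_eq_imp_space_eq[OF s] by simp
  note [measurable] = u g(1)
  interpret \<mu>: sigma_finite_measure \<mu> by (rule locally_finite_sigma_finite[OF \<mu>])
  interpret P: pair_sigma_finite \<mu> lborel ..
  define E where "E = {x. norm (u x) > t}"
  have E[measurable]: "E \<in> sets borel" unfolding E_def by measurable
  have fin_case: "ennreal t * ennpow (emeasure \<mu> F) p \<le> ennreal (K * ?D) * R"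
    if F: "F \<in> sets borel" "F \<subseteq> E" "emeasure \<mu> F < \<infinity>" for F
  proof -
    note [measurable] = F(1)
    obtain v where v: "emeasure \<mu> F = ennreal v" "v \<ge> 0" using F(3) by (cases "emeasure \<mu> F") auto
    show ?thesis
    proof (cases "v = 0")
      case True then show ?thesis using v by simp
    next
      case False
      then have v0: "v > 0" using v by simp
      have "ennreal t * emeasure \<mu> F = (\<integral>\<^sup>+x. ennreal t * indicator F x \<partial>\<mu>)"
        by (subst nn_integral_cmult_indicator) (auto simp: s F)
      also have "\<dots> \<le> (\<integral>\<^sup>+x. ennreal K * ((\<integral>\<^sup>+y. ?k x y * ennreal (g y) \<partial>lborel) * indicator F x) \<partial>\<mu>)"
      proof (rule nn_integral_mono)
        fix x
        show "ennreal t * indicator F x \<le> ennreal K * ((\<integral>\<^sup>+y. ?k x y * ennreal (g y) \<partial>lborel) * indicator F x)"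
        proof (cases "x \<in> F")
          case True
          then have "ennreal t \<le> ennreal (norm (u x))" using F(2) by (auto simp: E_def intro!: ennreal_leI)
          also note le
          finally show ?thesis using True by simp
        qed simp
      qed
      also have "\<dots> = ennreal K * (\<integral>\<^sup>+x. (\<integral>\<^sup>+y. ?k x y * ennreal (g y) \<partial>lborel) * indicator F x \<partial>\<mu>)"
        by (rule nn_integral_cmult) measurable
      also have "(\<integral>\<^sup>+x. (\<integral>\<^sup>+y. ?k x y * ennreal (g y) \<partial>lborel) * indicator F x \<partial>\<mu>)
         = (\<integral>\<^sup>+x. \<integral>\<^sup>+y. ?k x y * ennreal (g y) * indicator F x \<partial>lborel \<partial>\<mu>)"
        by (intro nn_integral_cong nn_integral_multc[symmetric]) measurable
      also have "\<dots> = (\<integral>\<^sup>+y. \<integral>\<^sup>+x. ?k x y * ennreal (g y) * indicator F x \<partial>\<mu> \<partial>lborel)"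
        by (rule P.Fubini'[symmetric]) measurable
      also have "\<dots> = (\<integral>\<^sup>+y. \<integral>\<^sup>+x. ennreal (g y) * (?k x y * indicator F x) \<partial>\<mu> \<partial>lborel)"
        by (simp add: mult_ac)
      also have "\<dots> = (\<integral>\<^sup>+y. ennreal (g y) * (\<integral>\<^sup>+x. ?k x y * indicator F x \<partial>\<mu>) \<partial>lborel)"
        by (intro nn_integral_cong nn_integral_cmult) measurable
      also have "\<dots> \<le> ennreal (?D * v powr (\<alpha> / ?n)) * R"
        unfolding R_def
      proof (rule nn_integral_le_cmult)
        show "?D * v powr (\<alpha> / ?n) > 0" using D v0 by simp
        fix y
        have "(\<integral>\<^sup>+x. ?k x y * indicator F x \<partial>\<mu>) \<le> ennreal ?D * (ennpow (emeasure \<mu> F) (\<alpha> / ?n) * ennpow (maximal \<mu> y) p)"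
          unfolding p_def by (rule kernel_integral_le_maximal[OF s F(1) F(3) \<alpha>])
        also have "\<dots> = ennreal (?D * v powr (\<alpha> / ?n)) * ennpow (maximal \<mu> y) p"
          using v D by (simp add: ennpow_ennreal ennreal_mult mult.assoc)
        finally have "ennreal (g y) * (\<integral>\<^sup>+x. ?k x y * indicator F x \<partial>\<mu>) \<le> ennreal (g y) * (ennreal (?D * v powr (\<alpha> / ?n)) * ennpow (maximal \<mu> y) p)"
          by (rule mult_left_mono) simp
        then show "ennreal (g y) * (\<integral>\<^sup>+x. ?k x y * indicator F x \<partial>\<mu>) \<le> ennreal (?D * v powr (\<alpha> / ?n)) * (ennreal (g y) * ennpow (maximal \<mu> y) p)"
          by (simp add: mult_ac)
      qed measurable
      finally have "ennreal t * ennreal v \<le> ennreal K * (ennreal (?D * v powr (\<alpha> / ?n)) * R)"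
        using v by (simp add: mult_left_mono)
      then have "ennreal (v powr (- (\<alpha> / ?n))) * (ennreal t * ennreal v) \<le> ennreal (v powr (- (\<alpha> / ?n))) * (ennreal K * (ennreal (?D * v powr (\<alpha> / ?n)) * R))"
        by (rule mult_left_mono) simp
      moreover have "ennreal (v powr (- (\<alpha> / ?n))) * (ennreal t * ennreal v) = ennreal t * ennpow (emeasure \<mu> F) p"
      proof -
        have "v powr (- \<delta>) * (t * v) = t * v powr (1 - \<delta>)" for \<delta>
          using v0 by (simp add: powr_diff powr_minus divide_inverse)
        then show ?thesis
          using v t unfolding p_def by (simp only: ennpow_ennreal ennreal_mult[symmetric] powr_ge_zero less_imp_le mult_nonneg_nonneg)
      qed
      moreover have "ennreal (v powr (- (\<alpha> / ?n))) * (ennreal K * (ennreal (?D * v powr (\<alpha> / ?n)) * R)) = ennreal (K * ?D) * R"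
      proof -
        have "v powr (- (\<alpha> / ?n)) * (K * (?D * v powr (\<alpha> / ?n))) = K * ?D"
          using v0 by (simp add: powr_minus field_simps)
        moreover have "ennreal (v powr (- (\<alpha> / ?n))) * (ennreal K * (ennreal (?D * v powr (\<alpha> / ?n)) * R)) = ennreal (v powr (- (\<alpha> / ?n)) * (K * (?D * v powr (\<alpha> / ?n)))) * R"
          using D K by (simp add: ennreal_mult mult.assoc)
        ultimately show ?thesis by (simp only:)
      qed
      ultimately show ?thesis by simp
    qed
  qed
  define b where "b = ennreal (1 / t) * (ennreal (K * ?D) * R)"
  have inv: "ennreal (1 / t) * (ennreal t * z) = z" "ennreal t * (ennreal (1 / t) * z) = z" for z
    using t by (simp_all add: mult.assoc[symmetric] ennreal_mult[symmetric])
  define F where "F k = E \<inter> cball 0 (real k)" for k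
  have Fm: "F k \<in> sets borel" for k unfolding F_def by measurable
  have "emeasure \<mu> (F k) \<le> ennpow b (1 / p)" for k
  proof -
    have "emeasure \<mu> (F k) \<le> emeasure \<mu> (cball 0 (real k))"
      by (intro emeasure_mono) (auto simp: F_def s)
    also have "\<dots> < \<infinity>" by (rule locally_finite_compact[OF \<mu> compact_cball])
    finally have "ennreal t * ennpow (emeasure \<mu> (F k)) p \<le> ennreal (K * ?D) * R"
      by (intro fin_case Fm) (auto simp: F_def)
    from mult_left_mono[OF this, of "ennreal (1 / t)"] have "ennpow (emeasure \<mu> (F k)) p \<le> b"
      by (simp add: inv b_def)
    from ennpow_mono[OF _ this, of "1 / p"] show ?thesis using p by (simp add: ennpow_ennpow)
  qed
  then have "(SUP k. emeasure \<mu> (F k)) \<le> ennpow b (1 / p)" by (rule SUP_least)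
  also have "(SUP k. emeasure \<mu> (F k)) = emeasure \<mu> (\<Union>k. F k)"
    by (rule SUP_emeasure_incseq) (auto simp: s Fm F_def incseq_def)
  also have "(\<Union>k. F k) = E"
    using real_arch_simple by (auto simp: F_def dist_norm)
  finally have "ennpow (emeasure \<mu> E) p \<le> b"
    using ennpow_mono[of p "emeasure \<mu> E" "ennpow b (1 / p)"] p(1) by (simp add: ennpow_ennpow)
  from mult_left_mono[OF this, of "ennreal t"]
  show "ennreal t * ennpow (emeasure \<mu> {x \<in> space \<mu>. norm (u x) > t}) (1 / (?n / (?n - \<alpha>))) \<le> ennreal (K * ?D) * (\<integral>\<^sup>+y. ennreal (g y) * ennpow (maximal \<mu> y) (1 - \<alpha> / ?n) \<partial>lborel)"
    unfolding p(2) by (simp add: b_def inv E_def R_def p_def)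
qed

section \<open>Testing on Dirac measures\<close>

lemma locally_finite_return: "locally_finite_borel (return borel x)"
  unfolding locally_finite_borel_def by (auto intro!: exI[of _ UNIV])

text \<open>
  A cube of side \<open>l\<close> containing both points forces \<open>\<bar>x - y\<bar> \<le> n l\<close>, through the sum norm.
\<close>

lemma maximal_return_le:
  fixes x y :: "real^'n::finite"
  assumes "x \<noteq> y"
  shows "maximal (return borel x) y \<le> ennreal ((real CARD('n) / norm (x - y)) ^ CARD('n))"
  unfolding maximal_def
proof (rule SUP_least)
  let ?n = "real CARD('n)"
  fix Q assume "Q \<in> {Q \<in> cubes. y \<in> Q}"
  then obtain a l where Q: "Q = cbox a (a + (\<chi> i. l))" and l: "l > 0" and y: "y \<in> Q" by (auto simp: cubes_def)
  have v: "emeasure lborel Q = ennreal (l ^ CARD('n))" unfolding Q using l by (intro emeasure_cube) simp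
  show "emeasure (return borel x) Q / emeasure lborel Q \<le> ennreal ((?n / norm (x - y)) ^ CARD('n))"
  proof (cases "x \<in> Q")
    case False
    then show ?thesis by (simp add: Q)
  next
    case True
    have "\<bar>(x - y) $ i\<bar> \<le> l" for i
      using True y unfolding Q by (simp add: mem_box_cart abs_le_iff) (smt (verit))
    then have "norm (x - y) \<le> ?n * l"
      using norm_le_l1_cart[of "x - y"] sum_bounded_above[of UNIV "\<lambda>i. \<bar>(x - y) $ i\<bar>" l] by simp
    then have "1 / l \<le> ?n / norm (x - y)" using l assms by (simp add: field_simps)
    then have "(1 / l) ^ CARD('n) \<le> (?n / norm (x - y)) ^ CARD('n)"
      using l by (intro power_mono) auto
    moreover have "emeasure (return borel x) Q / emeasure lborel Q = ennreal ((1 / l) ^ CARD('n))"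
      unfolding v using True l by (simp add: Q power_one_over divide_ennreal[symmetric])
    ultimately show ?thesis by (simp add: ennreal_leI)
  qed
qed

text \<open>
  Every level below \<open>\<bar>u x\<bar>\<close> has a level set of Dirac measure 1.
\<close>

lemma norm_le_weak_norm_return:
  fixes u :: "real^'n::finite \<Rightarrow> 'k::real_normed_vector"
  assumes u: "u \<in> borel_measurable borel" and q: "q > 0"
  shows "ennreal (norm (u x)) \<le> weak_norm q (return borel x) u"
proof (rule dense_le)
  fix z assume z: "z < ennreal (norm (u x))"
  then obtain t where t: "z = ennreal t" "t \<ge> 0" by (cases z) auto
  show "z \<le> weak_norm q (return borel x) u"
  proof (cases "t = 0")
    case True then show ?thesis using t by simp
  next
    case False
    then have t0: "t > 0" using t by simp
    have "t < norm (u x)" using z t by (simp add: ennreal_less_iff)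
    moreover have "{y. norm (u y) > t} \<in> sets borel" using u by measurable
    ultimately have "emeasure (return borel x) {y \<in> space (return borel x). norm (u y) > t} = ennreal 1"
      by simp
    then have "z = ennreal t * ennpow (emeasure (return borel x) {y \<in> space (return borel x). norm (u y) > t}) (1 / q)"
      using t ennpow_ennreal[of 1 "1 / q"] by simp
    also have "\<dots> \<le> weak_norm q (return borel x) u"
      unfolding weak_norm_def using t0 by (intro SUP_upper) simp
    finally show ?thesis .
  qed
qed

section \<open>The potential of a gradient\<close>

lemma norm_gradient_le: "norm (gradient f x) \<le> (\<Sum>i\<in>UNIV. norm (partial_deriv i f x))"
  unfolding norm_vec_def gradient_def by (rule order_trans[OF L2_set_le_sum]) auto

lemma norm_gradient_measurable:
  assumes "f \<in> Cc_infty" shows "(\<lambda>x. norm (gradient f x)) \<in> borel_measurable borel"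
proof -
  have "continuous_on UNIV (\<lambda>x. norm (gradient f x))"
    unfolding norm_vec_def gradient_def L2_set_def vec_lambda_beta
    by (intro continuous_intros smooth_continuous smooth_partial_deriv Cc_infty_smooth[OF assms])
  then show ?thesis by (rule borel_measurable_continuous_onI)
qed

lemma norm_gradient_bounded:
  assumes f: "f \<in> Cc_infty"
  shows "\<exists>B. \<forall>x. norm (gradient f x) \<le> B"
proof -
  have "\<exists>B. \<forall>x. norm (partial_deriv i f x) \<le> B" for i
    using Cc_infty_bounded[OF Cc_infty_partial_deriv[OF f, of i]] by metis
  then obtain B where "\<And>i x. norm (partial_deriv i f x) \<le> B i" by metis
  then have "norm (gradient f x) \<le> (\<Sum>i\<in>UNIV. B i)" for x
    by (intro order_trans[OF norm_gradient_le] sum_mono)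
  then show ?thesis by blast
qed

lemma norm_gradient_nn_integral_finite:
  assumes f: "f \<in> Cc_infty"
  shows "(\<integral>\<^sup>+x. ennreal (norm (gradient f x)) \<partial>lborel) < \<infinity>"
proof -
  have i: "integrable lborel (\<lambda>x. \<Sum>i\<in>UNIV. norm (partial_deriv i f x))"
    by (intro Bochner_Integration.integrable_sum Cc_infty_norm_integrable Cc_infty_partial_deriv f)
  have "(\<integral>\<^sup>+x. ennreal (norm (gradient f x)) \<partial>lborel) \<le> (\<integral>\<^sup>+x. ennreal (norm (\<Sum>i\<in>UNIV. norm (partial_deriv i f x))) \<partial>lborel)"
    using norm_gradient_le[of f] by (intro nn_integral_mono ennreal_leI) (simp add: sum_nonneg)
  also have "\<dots> < \<infinity>" using i by (simp add: integrable_iff_bounded)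
  finally show ?thesis .
qed

text \<open>
  The potential is a Bochner integral, which would be 0 if it diverged; for a gradient it converges,
  so it may be computed with extended nonnegative values.
\<close>

lemma riesz_potential_gradient:
  fixes f :: "real^'n::finite \<Rightarrow> 'k::real_normed_vector"
  assumes \<alpha>: "0 < \<alpha>" "\<alpha> < real CARD('n)" and f: "f \<in> Cc_infty"
  shows "ennreal (riesz_potential \<alpha> (\<lambda>y. norm (gradient f y)) x) = ennreal (riesz_const TYPE('n) \<alpha>) *
    (\<integral>\<^sup>+y. ennreal (1 / norm (x - y) powr (real CARD('n) - \<alpha>)) * ennreal (norm (gradient f y)) \<partial>lborel)"
    and "0 \<le> riesz_potential \<alpha> (\<lambda>y. norm (gradient f y)) x"
proof -
  let ?n = "real CARD('n)"
  let ?g = "\<lambda>y. norm (gradient f y)"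
  note [measurable] = norm_gradient_measurable[OF f]
  have c: "riesz_const TYPE('n) \<alpha> > 0" using \<alpha> by (rule riesz_const_pos)
  obtain B where B: "\<forall>x. ?g x \<le> B" using norm_gradient_bounded[OF f] by blast
  then have B0: "B \<ge> 0" using norm_ge_zero order_trans by blast
  have \<gamma>: "0 < ?n - \<alpha>" "?n - \<alpha> < DIM(real^'n)" using \<alpha> by simp_all
  obtain W where "\<And>B (q::real^'n \<Rightarrow> real) x. B \<ge> 0 \<Longrightarrow> q \<in> borel_measurable borel \<Longrightarrow> (\<And>y. 0 \<le> q y \<and> q y \<le> B) \<Longrightarrow>
       (\<integral>\<^sup>+y. ennreal (norm (x - y) powr (- (?n - \<alpha>)) * q y) \<partial>lborel) \<le> ennreal (B * W) + (\<integral>\<^sup>+y. ennreal (q y) \<partial>lborel)"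
    by (rule powr_potential_bound[OF \<gamma>], erule that)
  from this[of B ?g x]
  have "(\<integral>\<^sup>+y. ennreal (norm (x - y) powr (- (?n - \<alpha>)) * ?g y) \<partial>lborel) \<le> ennreal (B * W) + (\<integral>\<^sup>+y. ennreal (?g y) \<partial>lborel)"
    using B B0 by simp
  also have "\<dots> < \<infinity>" using norm_gradient_nn_integral_finite[OF f] by simp
  finally have fin: "(\<integral>\<^sup>+y. ennreal (1 / norm (x - y) powr (?n - \<alpha>) * ?g y) \<partial>lborel) < \<infinity>"
    by (simp only: powr_minus_divide)
  have "integrable lborel (\<lambda>y. 1 / norm (x - y) powr (?n - \<alpha>) * ?g y)"
    using fin by (intro integrableI_nonneg) auto
  then have "(\<integral>\<^sup>+y. ennreal (1 / norm (x - y) powr (?n - \<alpha>) * ?g y) \<partial>lborel) = ennreal (\<integral>y. 1 / norm (x - y) powr (?n - \<alpha>) * ?g y \<partial>lborel)"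
    by (intro nn_integral_eq_integral) auto
  then show "ennreal (riesz_potential \<alpha> ?g x) = ennreal (riesz_const TYPE('n) \<alpha>) *
    (\<integral>\<^sup>+y. ennreal (1 / norm (x - y) powr (?n - \<alpha>)) * ennreal (?g y) \<partial>lborel)"
  proof -
    assume J: "(\<integral>\<^sup>+y. ennreal (1 / norm (x - y) powr (?n - \<alpha>) * ?g y) \<partial>lborel) = ennreal (\<integral>y. 1 / norm (x - y) powr (?n - \<alpha>) * ?g y \<partial>lborel)"
    have "ennreal (1 / norm (x - y) powr (?n - \<alpha>)) * ennreal (?g y) = ennreal (1 / norm (x - y) powr (?n - \<alpha>) * ?g y)" for y
      by (rule ennreal_mult[symmetric]) auto
    moreover have "riesz_potential \<alpha> ?g x = riesz_const TYPE('n) \<alpha> * (\<integral>y. 1 / norm (x - y) powr (?n - \<alpha>) * ?g y \<partial>lborel)"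
      by (simp only: riesz_potential_def riesz_with_const_def real_scaleR_def)
    ultimately show ?thesis
      using c by (simp only: J ennreal_mult' less_imp_le)
  qed
  show "0 \<le> riesz_potential \<alpha> ?g x"
    unfolding riesz_potential_def riesz_with_const_def using c by (intro scaleR_nonneg_nonneg integral_nonneg) auto
qed

section \<open>The equivalence\<close>

theorem theorem1p2:
  fixes T :: "(real^'n::finite \<Rightarrow> 'k::real_normed_field) \<Rightarrow> real^'n \<Rightarrow> 'k"
    and \<alpha> :: real
  assumes "0 < \<alpha>" and "\<alpha> < real CARD('n)"
    and "\<And>f. f \<in> Cc_infty \<Longrightarrow> T f \<in> borel_measurable borel"
  shows "(\<exists>c::real. \<forall>f \<in> Cc_infty. \<forall>x.
            norm (T f x) \<le> c * riesz_potential \<alpha> (\<lambda>y. norm (gradient f y)) x)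
     \<longleftrightarrow>
         (\<exists>C::real. \<forall>\<mu>. locally_finite_borel \<mu> \<longrightarrow> (\<forall>f \<in> Cc_infty.
            weak_norm (real CARD('n) / (real CARD('n) - \<alpha>)) \<mu> (T f)
              \<le> ennreal C * (\<integral>\<^sup>+ x. ennreal (norm (gradient f x))
                    * ennpow (maximal \<mu> x) (1 - \<alpha> / real CARD('n)) \<partial>lborel)))"
    (is "(\<exists>c. ?P c) \<longleftrightarrow> (\<exists>C. ?Q C)")
proof
  let ?n = "real CARD('n)" and ?rc = "riesz_const TYPE('n) \<alpha>"
  note \<alpha> = assms(1,2)
  have rc: "?rc > 0" using \<alpha> by (rule riesz_const_pos)
  {
    assume "\<exists>c. ?P c"
    then obtain c where c: "?P c" by blast
    define K where "K = (\<bar>c\<bar> + 1) * ?rc"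
    have K: "K > 0" using rc by (simp add: K_def add_nonneg_pos)
    have "?Q (K * riesz_weak_const TYPE('n) \<alpha>)"
    proof (intro allI impI ballI)
      fix \<mu> :: "(real^'n) measure" and f :: "real^'n \<Rightarrow> 'k"
      assume \<mu>: "locally_finite_borel \<mu>" and f: "f \<in> Cc_infty"
      show "weak_norm (?n / (?n - \<alpha>)) \<mu> (T f) \<le> ennreal (K * riesz_weak_const TYPE('n) \<alpha>) *
         (\<integral>\<^sup>+ x. ennreal (norm (gradient f x)) * ennpow (maximal \<mu> x) (1 - \<alpha> / ?n) \<partial>lborel)"
      proof (rule riesz_weak_type[OF \<alpha> \<mu> assms(3)[OF f] norm_gradient_measurable[OF f] _ K])
        fix x
        let ?I = "riesz_potential \<alpha> (\<lambda>y. norm (gradient f y)) x"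
        have "norm (T f x) \<le> c * ?I" using c f by blast
        also have "\<dots> \<le> (\<bar>c\<bar> + 1) * ?I"
          using riesz_potential_gradient(2)[OF \<alpha> f, of x] by (intro mult_right_mono) auto
        finally have "ennreal (norm (T f x)) \<le> ennreal ((\<bar>c\<bar> + 1) * ?I)" by (rule ennreal_leI)
        also have "\<dots> = ennreal (\<bar>c\<bar> + 1) * ennreal ?I" by (rule ennreal_mult') simp
        also have "\<dots> = ennreal K * (\<integral>\<^sup>+y. ennreal (1 / norm (x - y) powr (?n - \<alpha>)) * ennreal (norm (gradient f y)) \<partial>lborel)"
          unfolding riesz_potential_gradient(1)[OF \<alpha> f] K_def
          using rc by (simp only: ennreal_mult' mult.assoc abs_ge_zero add_nonneg_nonneg zero_le_one)
        finally show "ennreal (norm (T f x)) \<le> ennreal K * (\<integral>\<^sup>+y. ennreal (1 / norm (x - y) powr (?n - \<alpha>)) * ennreal (norm (gradient f y)) \<partial>lborel)" .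
      qed simp
    qed
    then show "\<exists>C. ?Q C" by blast
  }
  {
    assume "\<exists>C. ?Q C"
    then obtain C where C: "?Q C" by blast
    define L where "L = (\<bar>C\<bar> * ?n powr (?n - \<alpha>)) / ?rc"
    have L: "L \<ge> 0" using rc by (simp add: L_def)
    have "?P L"
    proof (intro ballI allI)
      fix f :: "real^'n \<Rightarrow> 'k" and x
      assume f: "f \<in> Cc_infty"
      let ?I = "riesz_potential \<alpha> (\<lambda>y. norm (gradient f y)) x"
      let ?J = "\<integral>\<^sup>+y. ennreal (1 / norm (x - y) powr (?n - \<alpha>)) * ennreal (norm (gradient f y)) \<partial>lborel"
      note [measurable] = norm_gradient_measurable[OF f]
      have "ennreal (norm (T f x)) \<le> weak_norm (?n / (?n - \<alpha>)) (return borel x) (T f)"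
        using \<alpha> by (intro norm_le_weak_norm_return assms(3) f) simp
      also have "\<dots> \<le> ennreal C * (\<integral>\<^sup>+ y. ennreal (norm (gradient f y)) * ennpow (maximal (return borel x) y) (1 - \<alpha> / ?n) \<partial>lborel)"
        using C f locally_finite_return by blast
      also have "\<dots> \<le> ennreal \<bar>C\<bar> * (\<integral>\<^sup>+ y. ennreal (?n powr (?n - \<alpha>)) * (ennreal (1 / norm (x - y) powr (?n - \<alpha>)) * ennreal (norm (gradient f y))) \<partial>lborel)"
      proof (intro mult_mono nn_integral_mono_AE)
        show "AE y in lborel. ennreal (norm (gradient f y)) * ennpow (maximal (return borel x) y) (1 - \<alpha> / ?n)
           \<le> ennreal (?n powr (?n - \<alpha>)) * (ennreal (1 / norm (x - y) powr (?n - \<alpha>)) * ennreal (norm (gradient f y)))"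
        proof (use AE_lborel_singleton[of x] in eventually_elim)
          fix y assume y: "y \<noteq> x"
          have "ennpow (maximal (return borel x) y) (1 - \<alpha> / ?n) \<le> ennpow (ennreal ((?n / norm (x - y)) ^ CARD('n))) (1 - \<alpha> / ?n)"
            using \<alpha> y by (intro ennpow_mono maximal_return_le) auto
          also have "\<dots> = ennreal ((?n / norm (x - y)) powr (?n - \<alpha>))"
          proof -
            have "((?n / norm (x - y)) ^ CARD('n)) powr (1 - \<alpha> / ?n) = (?n / norm (x - y)) powr (?n * (1 - \<alpha> / ?n))"
              using y by (simp add: powr_powr flip: powr_realpow)
            also have "?n * (1 - \<alpha> / ?n) = ?n - \<alpha>" by (simp add: field_simps)
            finally show ?thesis by (simp add: ennpow_ennreal)
          qed
          also have "\<dots> = ennreal (?n powr (?n - \<alpha>)) * ennreal (1 / norm (x - y) powr (?n - \<alpha>))"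
            by (simp add: powr_divide ennreal_mult[symmetric])
          finally have "ennreal (norm (gradient f y)) * ennpow (maximal (return borel x) y) (1 - \<alpha> / ?n) \<le> ennreal (norm (gradient f y)) * (ennreal (?n powr (?n - \<alpha>)) * ennreal (1 / norm (x - y) powr (?n - \<alpha>)))"
            by (rule mult_left_mono) simp
          then show "ennreal (norm (gradient f y)) * ennpow (maximal (return borel x) y) (1 - \<alpha> / ?n)
             \<le> ennreal (?n powr (?n - \<alpha>)) * (ennreal (1 / norm (x - y) powr (?n - \<alpha>)) * ennreal (norm (gradient f y)))"
            by (simp add: mult_ac)
        qed
      qed (auto intro: ennreal_leI)
      also have "\<dots> = ennreal \<bar>C\<bar> * (ennreal (?n powr (?n - \<alpha>)) * ?J)"
        by (subst nn_integral_cmult) auto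
      also have "\<dots> = ennreal L * (ennreal ?rc * ?J)"
      proof -
        have "\<bar>C\<bar> * ?n powr (?n - \<alpha>) = L * ?rc" using rc by (simp add: L_def)
        then have "ennreal \<bar>C\<bar> * ennreal (?n powr (?n - \<alpha>)) = ennreal L * ennreal ?rc"
          using L rc by (simp add: ennreal_mult[symmetric])
        then show ?thesis by (simp add: mult.assoc[symmetric])
      qed
      also have "\<dots> = ennreal (L * ?I)"
        unfolding riesz_potential_gradient(1)[OF \<alpha> f, symmetric] using L by (simp add: ennreal_mult')
      finally show "norm (T f x) \<le> L * ?I"
        using L riesz_potential_gradient(2)[OF \<alpha> f, of x] by simp
    qed
    then show "\<exists>c. ?P c" by blast
  }
qed

end
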